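(* Assume that $\mathbb{E}(|\nu_v|^{2+\varepsilon}+|\omega_e|^{2+\varepsilon})$ is finite for some $\varepsilon>0$. Then, as $n\to\infty$, $$n^{-1/2}\,(\log Z_n-\mathbb{E}\log Z_n)\to N(0,\sigma_F^2)\quad\text{in distribution},$$ where $\sigma_F\in(0,\infty)$ is the constant, depending on the distributions of the edge and vertex weights, for which $n^{-1}\operatorname{Var}(\log Z_n)\to\sigma_F^2$ as $n\to\infty$ (this limit exists and is finite and strictly positive).
   Context: Let $H=(V_H,E_H)$ be a fixed finite graph with $|V_H|=h$, and let $G_n$ be the line graph (path) on the $n$ vertices $1,\dots,n$ with $i\sim i+1$. The cylinder graph $\mathcal{G}_n=G_n\times H$ is the Cartesian product: its vertex set is $V=\{1,\dots,n\}\times V_H$, and $(i,j)\sim(i',j')$ iff either $i\sim i'$ in $G_n$ and $j=j'$, or $i=i'$ and $j\sim j'$ in $H$. Let $E$ be its edge set. The vertex weights $\{\nu_v\}_{v\in V}$ are i.i.d. real-valued random variables; the edge weights $\{\omega_e\}_{e\in E}$ are i.i.d. real-valued random variables, independent of the vertex weights, not necessarily with the same distribution; the two distributions do not depend on $n$. A matching $\mathfrak{m}\subseteq E$ is a (possibly empty) set of pairwise vertex-disjoint edges; $\mathcal{M}$ is the set of all matchings of $\mathcal{G}_n$; $v\notin\mathfrak{m}$ means that $v$ is not covered by any edge of $\mathfrak{m}$. The Hamiltonian is $\mathcal{H}(\mathfrak{m})=\sum_{v\notin\mathfrak{m}}\nu_v+\sum_{e\in\mathfrak{m}}\omega_e$,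 and the partition function is $Z_n=\sum_{\mathfrak{m}\in\mathcal{M}}\exp(\mathcal{H}(\mathfrak{m}))$. $N(0,\sigma^2)$ denotes the centered Gaussian law with variance $\sigma^2$.
   Formalization: The graph H is assumed nonempty and the vertex- and edge-weight distributions are assumed not both point masses; otherwise log Z_n is deterministic, its variance is 0, and the claim that σ_F is strictly positive fails. *)

theory Defs
  imports "HOL-Probability.Probability"
begin

definition simple_graph :: "'v set \<Rightarrow> 'v set set \<Rightarrow> bool" where
  "simple_graph V E \<longleftrightarrow> E \<subseteq> {e. e \<subseteq> V \<and> card e = 2}"

definition path_verts :: "nat \<Rightarrow> nat set" where
  "path_verts n = {1..n}"

definition path_edges :: "nat \<Rightarrow> nat set set" where
  "path_edges n = {{i, i + 1} | i. 1 \<le> i \<and> i + 1 \<le> n}"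

definition cart_edges :: "'a set \<Rightarrow> 'a set set \<Rightarrow> 'b set \<Rightarrow> 'b set set \<Rightarrow> ('a \<times> 'b) set set" where
  "cart_edges VG EG VH EH =
     {{(i, j), (i', j')} | i j i' j'.
        ({i, i'} \<in> EG \<and> j = j' \<and> j \<in> VH) \<or> (i = i' \<and> i \<in> VG \<and> {j, j'} \<in> EH)}"

definition cyl_verts :: "nat \<Rightarrow> 'h set \<Rightarrow> (nat \<times> 'h) set" where
  "cyl_verts n VH = path_verts n \<times> VH"

definition cyl_edges :: "nat \<Rightarrow> 'h set \<Rightarrow> 'h set set \<Rightarrow> (nat \<times> 'h) set set" where
  "cyl_edges n VH EH = cart_edges (path_verts n) (path_edges n) VH EH"

definition matchings :: "'v set set \<Rightarrow> 'v set set set" where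
  "matchings E = {m. m \<subseteq> E \<and> disjoint m}"

definition hamiltonian :: "'v set \<Rightarrow> ('v \<Rightarrow> real) \<Rightarrow> ('v set \<Rightarrow> real) \<Rightarrow> 'v set set \<Rightarrow> real" where
  "hamiltonian V nu om m = (\<Sum>v \<in> V - \<Union>m. nu v) + (\<Sum>e \<in> m. om e)"

definition partition_fn ::
  "'v set \<Rightarrow> 'v set set \<Rightarrow> ('v \<Rightarrow> real) \<Rightarrow> ('v set \<Rightarrow> real) \<Rightarrow> real" where
  "partition_fn V E nu om = (\<Sum>m \<in> matchings E. exp (hamiltonian V nu om m))"

definition log_Z :: "'h set \<Rightarrow> 'h set set \<Rightarrow> nat \<Rightarrow> (nat \<times> 'h \<Rightarrow> 'w \<Rightarrow> real) \<Rightarrow>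
    ((nat \<times> 'h) set \<Rightarrow> 'w \<Rightarrow> real) \<Rightarrow> 'w \<Rightarrow> real" where
  "log_Z VH EH n nu om x =
     ln (partition_fn (cyl_verts n VH) (cyl_edges n VH EH) (\<lambda>v. nu v x) (\<lambda>e. om e x))"

text \<open>The index set \<open>V <+> E\<close> makes vertex and edge weights jointly independent, which covers both
  independence within each family and independence of the two families.\<close>

definition random_weights :: "'w measure \<Rightarrow> real measure \<Rightarrow> real measure \<Rightarrow> 'v set \<Rightarrow> 'v set set \<Rightarrow>
    ('v \<Rightarrow> 'w \<Rightarrow> real) \<Rightarrow> ('v set \<Rightarrow> 'w \<Rightarrow> real) \<Rightarrow> bool" where
  "random_weights M mu eta V E nu om \<longleftrightarrow>
     prob_space M \<and>
     prob_space.indep_vars M (\<lambda>_. borel) (case_sum nu om) (V <+> E) \<and>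
     (\<forall>v\<in>V. distr M borel (nu v) = mu) \<and> (\<forall>e\<in>E. distr M borel (om e) = eta)"

definition degenerate_law :: "real measure \<Rightarrow> bool" where
  "degenerate_law mu \<longleftrightarrow> (\<exists>c. mu = return borel c)"

text \<open>The second argument is the standard deviation, as in \<^const>\<open>normal_density\<close>.\<close>

definition gaussian_law :: "real \<Rightarrow> real \<Rightarrow> real measure" where
  "gaussian_law m s = density lborel (\<lambda>x. ennreal (normal_density m s x))"

end

theory Submission
  imports Defs
begin

text \<open>
  Let \<open>F a b\<close> be the logarithm of the partition function of the columns \<open>a + 1, \<dots>, b\<close>.
  Deleting the edges between two adjacent columns changes \<open>F a c\<close> into the sum of the independent
  variables \<open>F a b\<close> and \<open>F b c\<close>, and the defect lies between \<open>0\<close> and a sum of boundedly many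
  local terms, so its standard deviation is at most a constant \<open>C\<close>. Cutting \<open>K\<close> blocks of length
  \<open>L\<close> apart by repeated halving produces, at each level, independent errors; summing the levels, the
  total error has standard deviation \<open>O(C sqrt K)\<close>, with a constant that does not depend on \<open>L\<close>.
  Relative to \<open>sqrt (K * L)\<close> this is \<open>O(1 / sqrt L)\<close>, so the classical central limit theorem for
  the i.i.d. blocks passes to the limit \<open>L \<rightarrow> \<infinity>\<close>, and the normalised standard deviations form a Cauchy
  sequence.

  The limit variance is positive because \<open>F\<close> is increasing in every weight: one nondegenerate weight
  in each column has a covariance with \<open>F 0 n\<close> bounded below, and the Cauchy-Schwarz inequality
  applied to the sum of the corresponding indicators gives linear growth of the variance.
\<close>

section \<open>Standard deviations\<close>

text \<open>The defects at successive cuts are dependent, since each involves the free energies on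
  both sides. The triangle inequality over \<open>K\<close> cuts would cost \<open>C * K\<close>,
  which is not small against \<open>sqrt (K * L)\<close> for large \<open>K\<close>. Halving helps
  because the errors on the two sides of a cut depend on disjoint sets of columns: their variances
  add, and the triangle inequality serves only to attach the defect of that cut. Both tools live in
  L2, so standard deviations are tracked throughout, and characteristic functions enter only when
  laws are compared.

  The hypotheses give a separate probability space for each \<open>n\<close>, whereas cutting
  compares different ranges of columns on one space. The argument therefore runs on a product
  measure that carries all weights of an infinite cylinder, and returns through the law of
  \<open>log_Z\<close>.

  For positivity, the partition function has the form \<open>A + B * exp x\<close> in each weight
  \<open>x\<close>. The response to that weight depends on the random ratio \<open>A / B\<close>,
  which the nearby edges control uniformly in \<open>n\<close>.\<close>

definition square_integrable :: "'a measure \<Rightarrow> ('a \<Rightarrow> real) \<Rightarrow> bool" where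
  "square_integrable M X \<longleftrightarrow> X \<in> borel_measurable M \<and> integrable M (\<lambda>x. (X x)\<^sup>2)"

context prob_space
begin

definition sdev :: "('a \<Rightarrow> real) \<Rightarrow> real" where
  "sdev X = sqrt (variance X)"

lemma square_integrableD:
  assumes "square_integrable M X"
  shows "X \<in> borel_measurable M" "integrable M (\<lambda>x. (X x)\<^sup>2)" "integrable M X"
proof -
  show X: "X \<in> borel_measurable M" and sq: "integrable M (\<lambda>x. (X x)\<^sup>2)"
    using assms by (simp_all add: square_integrable_def)
  show "integrable M X"
    by (rule square_integrable_imp_integrable[OF X sq])
qed

lemma square_integrable_mult:
  assumes "square_integrable M X" "square_integrable M Y"
  shows "integrable M (\<lambda>x. X x * Y x)"
proof (rule Bochner_Integration.integrable_bound)
  show "integrable M (\<lambda>x. (X x)\<^sup>2 + (Y x)\<^sup>2)"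
    using assms by (auto simp: square_integrable_def)
  show "(\<lambda>x. X x * Y x) \<in> borel_measurable M"
    using assms by (auto simp: square_integrable_def)
  have "\<bar>a * b\<bar> \<le> a\<^sup>2 + b\<^sup>2" for a b :: real
  proof -
    have "2 * (\<bar>a\<bar> * \<bar>b\<bar>) \<le> \<bar>a\<bar>\<^sup>2 + \<bar>b\<bar>\<^sup>2"
      using sum_squares_bound[of "\<bar>a\<bar>" "\<bar>b\<bar>"] by (simp only: mult.assoc)
    moreover have "0 \<le> \<bar>a\<bar> * \<bar>b\<bar>" by simp
    ultimately have "\<bar>a\<bar> * \<bar>b\<bar> \<le> \<bar>a\<bar>\<^sup>2 + \<bar>b\<bar>\<^sup>2" by linarith
    then show ?thesis by (simp add: abs_mult)
  qed
  then show "AE x in M. norm (X x * Y x) \<le> norm ((X x)\<^sup>2 + (Y x)\<^sup>2)"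
    by simp
qed

lemma square_integrable_add:
  assumes "square_integrable M X" "square_integrable M Y"
  shows "square_integrable M (\<lambda>x. X x + Y x)"
proof -
  have "integrable M (\<lambda>x. (X x)\<^sup>2 + (Y x)\<^sup>2 + 2 * (X x * Y x))"
    using assms square_integrable_mult[OF assms] by (simp add: square_integrable_def)
  then show ?thesis
    using square_integrableD(1)[OF assms(1)] square_integrableD(1)[OF assms(2)]
    by (simp add: square_integrable_def power2_sum mult.assoc)
qed

lemma square_integrable_cmult:
  "square_integrable M X \<Longrightarrow> square_integrable M (\<lambda>x. c * X x)"
  by (auto simp: square_integrable_def power_mult_distrib)

lemma square_integrable_diff:
  assumes "square_integrable M X" "square_integrable M Y"
  shows "square_integrable M (\<lambda>x. X x - Y x)"
  using square_integrable_add[OF assms(1) square_integrable_cmult[OF assms(2), of "-1"]] by simp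

lemma square_integrable_const: "square_integrable M (\<lambda>x. c)"
  by (simp add: square_integrable_def)

lemma square_integrable_sum:
  "(\<And>i. i \<in> I \<Longrightarrow> square_integrable M (X i)) \<Longrightarrow> square_integrable M (\<lambda>x. \<Sum>i\<in>I. X i x)"
  by (induction I rule: infinite_finite_induct)
     (auto simp: square_integrable_const intro!: square_integrable_add)

text \<open>Cauchy-Schwarz: the expectation of \<open>(X - t * Y)^2\<close> is a nonnegative
  quadratic in \<open>t\<close>.\<close>

lemma expectation_mult_le:
  assumes "square_integrable M X" "square_integrable M Y"
  shows "(expectation (\<lambda>x. X x * Y x))\<^sup>2 \<le> expectation (\<lambda>x. (X x)\<^sup>2) * expectation (\<lambda>x. (Y x)\<^sup>2)"
proof -
  define a b c where "a = expectation (\<lambda>x. (Y x)\<^sup>2)" and "b = expectation (\<lambda>x. X x * Y x)"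
    and "c = expectation (\<lambda>x. (X x)\<^sup>2)"
  note int = square_integrableD(2)[OF assms(1)] square_integrableD(2)[OF assms(2)]
    square_integrable_mult[OF assms]
  have nonneg: "0 \<le> c - 2 * t * b + t\<^sup>2 * a" for t
  proof -
    have "0 \<le> expectation (\<lambda>x. (X x - t * Y x)\<^sup>2)" by simp
    also have "(\<lambda>x. (X x - t * Y x)\<^sup>2) = (\<lambda>x. (X x)\<^sup>2 - (2 * t) * (X x * Y x) + t\<^sup>2 * (Y x)\<^sup>2)"
      by (auto simp: power2_eq_square algebra_simps)
    also have "expectation \<dots> = c - 2 * t * b + t\<^sup>2 * a"
      using int by (simp add: a_def b_def c_def)
    finally show ?thesis .
  qed
  show ?thesis
  proof (cases "a = 0")
    case True
    have "b = 0"
    proof (rule ccontr)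
      assume "b \<noteq> 0"
      \<comment> \<open>With \<open>a = 0\<close> the quadratic is linear in \<open>t\<close>; this
        \<open>t\<close> gives it the value -1.\<close>
      then show False using nonneg[of "(c + 1) / (2 * b)"] True by simp
    qed
    then show ?thesis using True by (simp add: a_def b_def)
  next
    case False
    then have "0 < a" unfolding a_def by (simp add: less_le)
    \<comment> \<open>The minimiser of the quadratic.\<close>
    have "0 \<le> c - 2 * (b / a) * b + (b / a)\<^sup>2 * a" by (rule nonneg)
    also have "\<dots> = c - b\<^sup>2 / a" using \<open>0 < a\<close> by (simp add: power2_eq_square field_simps)
    finally show ?thesis using \<open>0 < a\<close> by (simp add: a_def b_def c_def field_simps)
  qed
qed

lemma sdev_nonneg: "0 \<le> sdev X"
  by (simp add: sdev_def variance_positive)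

lemma sdev_squared: "(sdev X)\<^sup>2 = variance X"
  by (simp add: sdev_def variance_positive)

lemma covariance_le:
  assumes "square_integrable M X" "square_integrable M Y"
  shows "expectation (\<lambda>x. (X x - expectation X) * (Y x - expectation Y)) \<le> sdev X * sdev Y"
proof -
  let ?b = "expectation (\<lambda>x. (X x - expectation X) * (Y x - expectation Y))"
  have "?b\<^sup>2 \<le> variance X * variance Y"
    using assms by (intro expectation_mult_le square_integrable_diff square_integrable_const)
  then have "\<bar>?b\<bar> \<le> sqrt (variance X * variance Y)"
    using real_le_rsqrt[of "\<bar>?b\<bar>"] by simp
  then show ?thesis by (simp add: sdev_def real_sqrt_mult)
qed

lemma variance_add:
  assumes "square_integrable M X" "square_integrable M Y"
  shows "variance (\<lambda>x. X x + Y x) = variance X + variance Y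
    + 2 * expectation (\<lambda>x. (X x - expectation X) * (Y x - expectation Y))"
proof -
  note int = square_integrableD(3)[OF assms(1)] square_integrableD(3)[OF assms(2)]
  have X: "square_integrable M (\<lambda>x. X x - expectation X)"
    and Y: "square_integrable M (\<lambda>x. Y x - expectation Y)"
    using assms by (auto intro!: square_integrable_diff square_integrable_const)
  have "variance (\<lambda>x. X x + Y x) = expectation (\<lambda>x. (X x - expectation X)\<^sup>2 + (Y x - expectation Y)\<^sup>2
      + 2 * ((X x - expectation X) * (Y x - expectation Y)))"
    using int by (intro Bochner_Integration.integral_cong) (auto simp: power2_eq_square algebra_simps)
  also have "\<dots> = variance X + variance Y
    + 2 * expectation (\<lambda>x. (X x - expectation X) * (Y x - expectation Y))"
    using square_integrableD(2)[OF X] square_integrableD(2)[OF Y] square_integrable_mult[OF X Y] by simp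
  finally show ?thesis .
qed

lemma sdev_add_le:
  assumes "square_integrable M X" "square_integrable M Y"
  shows "sdev (\<lambda>x. X x + Y x) \<le> sdev X + sdev Y"
proof -
  have "(sdev (\<lambda>x. X x + Y x))\<^sup>2 \<le> (sdev X + sdev Y)\<^sup>2"
    using covariance_le[OF assms] by (simp add: sdev_squared variance_add[OF assms] power2_sum)
  then show ?thesis
    using sdev_nonneg by (meson add_nonneg_nonneg power2_le_imp_le)
qed

lemma sdev_cmult: "sdev (\<lambda>x. c * X x) = \<bar>c\<bar> * sdev X"
proof -
  have "variance (\<lambda>x. c * X x) = expectation (\<lambda>x. c\<^sup>2 * (X x - expectation X)\<^sup>2)"
    by (intro Bochner_Integration.integral_cong) (auto simp: power2_eq_square algebra_simps)
  then show ?thesis by (simp add: sdev_def real_sqrt_mult)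
qed

lemma sdev_diff_le:
  assumes "square_integrable M X" "square_integrable M Y"
  shows "\<bar>sdev X - sdev Y\<bar> \<le> sdev (\<lambda>x. X x - Y x)"
  using sdev_add_le[OF square_integrable_diff[OF assms] assms(2)]
    sdev_add_le[OF square_integrable_diff[OF assms(2,1)] assms(1)]
    sdev_cmult[of "-1" "\<lambda>x. X x - Y x"] by simp

lemma variance_indep_add:
  assumes "square_integrable M X" "square_integrable M Y" "indep_var borel X borel Y"
  shows "variance (\<lambda>x. X x + Y x) = variance X + variance Y"
proof -
  have "indep_var borel ((\<lambda>y. y - expectation X) \<circ> X) borel ((\<lambda>y. y - expectation Y) \<circ> Y)"
    by (rule indep_var_compose[OF assms(3)]) simp_all
  then have "expectation (\<lambda>x. (X x - expectation X) * (Y x - expectation Y))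
      = expectation (\<lambda>x. X x - expectation X) * expectation (\<lambda>x. Y x - expectation Y)"
    using square_integrableD(3)[OF assms(1)] square_integrableD(3)[OF assms(2)]
    by (subst indep_var_lebesgue_integral) (simp_all add: comp_def)
  also have "expectation (\<lambda>x. X x - expectation X) = 0"
    using square_integrableD(3)[OF assms(1)] by (simp add: prob_space)
  finally show ?thesis by (simp add: variance_add[OF assms(1,2)])
qed

lemma expectation_abs_le_sdev:
  assumes "square_integrable M X"
  shows "expectation (\<lambda>x. \<bar>X x - expectation X\<bar>) \<le> sdev X"
proof -
  let ?Y = "\<lambda>x. \<bar>X x - expectation X\<bar>"
  have "square_integrable M (\<lambda>x. X x - expectation X)"
    by (intro square_integrable_diff square_integrable_const assms)
  then have "square_integrable M ?Y" by (auto simp: square_integrable_def)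
  from expectation_mult_le[OF this square_integrable_const[of 1]]
  have "(expectation ?Y)\<^sup>2 \<le> variance X" by (simp add: prob_space)
  then show ?thesis unfolding sdev_def by (rule real_le_rsqrt)
qed

text \<open>Lets an L1 distance, hence by \<open>expectation_abs_le_sdev\<close> a standard
  deviation, control characteristic functions; \<open>iexp\<close> is 1-Lipschitz.\<close>

lemma char_diff_le:
  assumes [measurable]: "X \<in> borel_measurable M" "Y \<in> borel_measurable M"
    and int: "integrable M (\<lambda>x. X x - Y x)"
  shows "cmod (char (distr M borel X) t - char (distr M borel Y) t)
    \<le> \<bar>t\<bar> * expectation (\<lambda>x. \<bar>X x - Y x\<bar>)"
proof -
  have iexp_diff: "cmod (iexp a - iexp b) \<le> \<bar>a - b\<bar>" for a b
  proof -
    have "iexp a - iexp b = iexp b * (iexp (a - b) - 1)"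
      by (simp add: right_diff_distrib mult_exp_exp)
    also have "cmod \<dots> \<le> \<bar>a - b\<bar>"
      using iexp_approx1[of "a - b" 0] by (simp add: norm_mult)
    finally show ?thesis .
  qed
  have "char (distr M borel X) t - char (distr M borel Y) t
      = (CLINT x|M. iexp (t * X x)) - (CLINT x|M. iexp (t * Y x))"
    by (simp add: char_def integral_distr)
  also have "\<dots> = (CLINT x|M. iexp (t * X x) - iexp (t * Y x))"
    by (intro Bochner_Integration.integral_diff[symmetric] integrable_iexp) auto
  also have "cmod \<dots> \<le> expectation (\<lambda>x. cmod (iexp (t * X x) - iexp (t * Y x)))"
    by (rule integral_norm_bound)
  also have "\<dots> \<le> expectation (\<lambda>x. \<bar>t\<bar> * \<bar>X x - Y x\<bar>)"
  proof (rule integral_mono_AE')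
    show "integrable M (\<lambda>x. \<bar>t\<bar> * \<bar>X x - Y x\<bar>)"
      using int by (intro integrable_mult_right integrable_abs)
    show "AE x in M. cmod (iexp (t * X x) - iexp (t * Y x)) \<le> \<bar>t\<bar> * \<bar>X x - Y x\<bar>"
    proof (rule AE_I2)
      fix x
      have "cmod (iexp (t * X x) - iexp (t * Y x)) \<le> \<bar>t * X x - t * Y x\<bar>"
        by (rule iexp_diff)
      also have "t * X x - t * Y x = t * (X x - Y x)"
        by (rule right_diff_distrib[symmetric])
      finally show "cmod (iexp (t * X x) - iexp (t * Y x)) \<le> \<bar>t\<bar> * \<bar>X x - Y x\<bar>"
        by (simp only: abs_mult)
    qed
  qed simp
  finally show ?thesis by simp
qed

end

text \<open>Closes the induction in \<open>sdev_block_error\<close>: for \<open>K = K1 + K2\<close>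
  it is the expanded form of \<open>(5 * sqrt K1 - 4)^2 + (5 * sqrt K2 - 4)^2 \<le> (5 * sqrt K -
  5)^2\<close>. The roots of the two halves add up to nearly \<open>sqrt 2 * sqrt K\<close>;
  rounding is worst at \<open>K = 3\<close>.\<close>

lemma sqrt_halving:
  fixes K :: nat
  assumes "2 \<le> K"
  shows "50 * sqrt K + 7 \<le> 40 * (sqrt (K div 2) + sqrt (K - K div 2))"
proof -
  define p q s where "p = sqrt (K div 2)" and "q = sqrt (K - K div 2)" and "s = sqrt K"
  have nonneg: "0 \<le> p" "0 \<le> q" "0 \<le> s" by (auto simp: p_def q_def s_def)
  define k where "k = K div 2"
  have K: "K = 2 * k \<or> K = 2 * k + 1" "1 \<le> k" using assms by (auto simp: k_def)
  \<comment> \<open>Equality holds at \<open>K = 3\<close>, the most unbalanced split.\<close>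
  have "9 * (k * (K - k)) \<ge> 2 * K^2"
  proof -
    have "k \<le> k * k" by simp
    with K(2) have "2 \<le> k + k * k" by linarith
    with K show ?thesis by (auto simp: power2_eq_square algebra_simps)
  qed
  then have "real (2 * K^2) \<le> real (9 * (k * (K - k)))" by (simp only: of_nat_le_iff)
  then have "2 * (s\<^sup>2)\<^sup>2 \<le> 9 * (p * q)\<^sup>2"
    by (simp add: p_def q_def s_def k_def power_mult_distrib)
  \<comment> \<open>\<open>47 / 100\<close> is a rational just below
    \<open>sqrt 2 / 3\<close>.\<close>
  moreover have "(47 / 100 * s\<^sup>2)\<^sup>2 = 2209 / 10000 * (s\<^sup>2)\<^sup>2"
    by (simp add: power_mult_distrib power_divide)
  ultimately have "(47 / 100 * s\<^sup>2)\<^sup>2 \<le> (p * q)\<^sup>2"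
    using zero_le_power2[of "p * q"] by linarith
  then have "47 / 100 * s\<^sup>2 \<le> p * q" by (rule power2_le_imp_le) (use nonneg in simp)
  moreover have "s\<^sup>2 = p\<^sup>2 + q\<^sup>2"
  proof -
    have "K = K div 2 + (K - K div 2)" by simp
    then have "real K = real (K div 2) + real (K - K div 2)" by (metis of_nat_add)
    then show ?thesis by (simp add: p_def q_def s_def del: of_nat_diff)
  qed
  \<comment> \<open>\<open>1.39^2 = 1.9321\<close> stays below \<open>1 + 2 * 0.47\<close>, the
    multiple of \<open>s^2\<close> that bounds \<open>(p + q)^2\<close> from below.\<close>
  moreover have "(139 / 100 * s)\<^sup>2 = 19321 / 10000 * s\<^sup>2"
    by (simp add: power_mult_distrib power_divide)
  ultimately have "(139 / 100 * s)\<^sup>2 \<le> (p + q)\<^sup>2"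
    using zero_le_power2[of s] unfolding power2_sum mult.assoc by linarith
  then have "139 / 100 * s \<le> p + q" by (rule power2_le_imp_le) (use nonneg in simp)
  \<comment> \<open>\<open>40 * 1.39 = 55.6\<close> leaves \<open>5.6 * s\<close> to cover the
    constant 7, and \<open>s \<ge> 1.4\<close> suffices.\<close>
  moreover have "14 / 10 \<le> s"
    unfolding s_def by (rule real_le_rsqrt) (use assms in \<open>simp add: power2_eq_square\<close>)
  ultimately show ?thesis by (simp add: p_def q_def s_def)
qed

lemma div_ratio_tendsto:
  assumes "0 < (L::nat)"
  shows "(\<lambda>n. real (n div L) / real n) \<longlonglongrightarrow> 1 / real L"
proof (rule real_tendsto_sandwich)
  show "(\<lambda>n. 1 / real L - 1 / real n) \<longlonglongrightarrow> 1 / real L"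
    using tendsto_diff[OF tendsto_const lim_1_over_n] by simp
  have "real n / real L - 1 \<le> real (n div L) \<and> real (n div L) \<le> real n / real L" for n
  proof -
    have "n < L * (n div L) + L" using assms dividend_less_times_div[of L n] by simp
    then have "real n < real (L * (n div L) + L)" by (simp only: of_nat_less_iff)
    moreover have "real (L * (n div L)) \<le> real n" by (simp only: of_nat_le_iff) simp
    ultimately show ?thesis using assms by (simp add: field_simps)
  qed
  note * = this
  show "\<forall>\<^sub>F n in sequentially. 1 / real L - 1 / real n \<le> real (n div L) / real n"
    using eventually_gt_at_top[of 0]
  proof eventually_elim
    case (elim n)
    have "1 / real L - 1 / real n = (real n / real L - 1) / real n"
      using elim assms by (simp add: field_simps)
    also have "\<dots> \<le> real (n div L) / real n" using *[of n] by (intro divide_right_mono) auto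
    finally show ?case .
  qed
  show "\<forall>\<^sub>F n in sequentially. real (n div L) / real n \<le> 1 / real L"
    using eventually_gt_at_top[of 0]
  proof eventually_elim
    case (elim n)
    have "real (n div L) / real n \<le> (real n / real L) / real n"
      using *[of n] by (intro divide_right_mono) auto
    also have "\<dots> = 1 / real L" using elim by simp
    finally show ?case .
  qed
qed simp

section \<open>Central limit theorem for nearly additive processes\<close>

text \<open>\<open>A a b\<close> abstracts the random variables determined by the columns
  \<open>a + 1, ..., b\<close>. Closure under sums and differences keeps block errors inside the
  class, and \<open>A_indep\<close> makes the two sides of a cut independent.
  \<open>indep_blocks\<close> is separate because the classical limit theorem wants joint
  independence of all blocks.\<close>

locale near_additive_process = prob_space M for M :: "'a measure" +
  fixes f :: "nat \<Rightarrow> nat \<Rightarrow> 'a \<Rightarrow> real"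
    and A :: "nat \<Rightarrow> nat \<Rightarrow> ('a \<Rightarrow> real) set"
    and C0 :: real
  assumes sq: "\<And>a b. square_integrable M (f a b)"
    and f_in: "\<And>a b. a \<le> b \<Longrightarrow> f a b \<in> A a b"
    and A_mono: "\<And>a b a' b'. a \<le> a' \<Longrightarrow> b' \<le> b \<Longrightarrow> A a' b' \<subseteq> A a b"
    and A_add: "\<And>a b X Y. X \<in> A a b \<Longrightarrow> Y \<in> A a b \<Longrightarrow> (\<lambda>x. X x + Y x) \<in> A a b"
    and A_diff: "\<And>a b X Y. X \<in> A a b \<Longrightarrow> Y \<in> A a b \<Longrightarrow> (\<lambda>x. X x - Y x) \<in> A a b"
    and A_zero: "\<And>a b. (\<lambda>x. 0) \<in> A a b"
    and A_indep: "\<And>a b c X Y. X \<in> A a b \<Longrightarrow> Y \<in> A b c \<Longrightarrow> indep_var borel X borel Y"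
    and defect: "\<And>a b c. a \<le> b \<Longrightarrow> b \<le> c \<Longrightarrow> sdev (\<lambda>x. f a c x - f a b x - f b c x) \<le> C0"
    and stationary: "\<And>a m. distr M borel (f a (a + m)) = distr M borel (f 0 m)"
    and indep_blocks: "\<And>L. indep_vars (\<lambda>_. borel) (\<lambda>k. f (k * L) (k * L + L)) UNIV"
begin

lemma sq_meas [measurable]: "f a b \<in> borel_measurable M"
  using sq by (rule square_integrableD)

lemma C0_nonneg: "0 \<le> C0"
  using defect[of 0 0 0] sdev_nonneg order_trans by blast

lemma expectation_stationary: "expectation (f a (a + m)) = expectation (f 0 m)"
  using arg_cong[OF stationary[of a m], of "\<lambda>D. integral\<^sup>L D (\<lambda>y. y)"] by (simp add: integral_distr)

lemma variance_stationary: "variance (f a (a + m)) = variance (f 0 m)"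
  using arg_cong[OF stationary[of a m], of "\<lambda>D. integral\<^sup>L D (\<lambda>y. (y - expectation (f 0 m))\<^sup>2)"]
  by (simp add: integral_distr expectation_stationary)

lemma sdev_stationary: "sdev (f a (a + m)) = sdev (f 0 m)"
  by (simp add: sdev_def variance_stationary)

definition block_sum :: "nat \<Rightarrow> nat \<Rightarrow> nat \<Rightarrow> 'a \<Rightarrow> real" where
  "block_sum L a K x = (\<Sum>k<K. f (a + k * L) (a + k * L + L) x)"

lemma block_sum_in: "block_sum L a K \<in> A a (a + K * L)"
proof (induction K)
  case 0
  then show ?case using A_zero by (simp add: block_sum_def[abs_def])
next
  case (Suc K)
  have "block_sum L a K \<in> A a (a + Suc K * L)"
    using Suc A_mono[of a a "a + K * L" "a + Suc K * L"] by auto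
  moreover have "f (a + K * L) (a + K * L + L) \<in> A a (a + Suc K * L)"
    using f_in[of "a + K * L" "a + K * L + L"] A_mono[of a "a + K * L" "a + K * L + L" "a + Suc K * L"]
    by (auto simp: algebra_simps)
  ultimately show ?case using A_add by (simp add: block_sum_def[abs_def])
qed

lemma sq_block_sum: "square_integrable M (block_sum L a K)"
  unfolding block_sum_def[abs_def] by (intro square_integrable_sum sq)

lemma block_sum_add:
  "block_sum L a (K1 + K2) x = block_sum L a K1 x + block_sum L (a + K1 * L) K2 x"
proof -
  have "{..<K1 + K2} = {..<K1} \<union> {K1..<K1 + K2}" by auto
  then have "block_sum L a (K1 + K2) x
      = block_sum L a K1 x + (\<Sum>k\<in>{K1..<K1 + K2}. f (a + k * L) (a + k * L + L) x)"
    unfolding block_sum_def by (simp add: sum.union_disjoint ivl_disj_int)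
  also have "(\<Sum>k\<in>{K1..<K1 + K2}. f (a + k * L) (a + k * L + L) x) = block_sum L (a + K1 * L) K2 x"
    unfolding block_sum_def
    by (rule sum.reindex_bij_witness[of _ "\<lambda>k. k + K1" "\<lambda>k. k - K1"]) (auto simp: algebra_simps)
  finally show ?thesis .
qed

lemma variance_block_sum: "variance (block_sum L a K) = real K * variance (f 0 L)"
proof (induction K)
  case 0
  then show ?case by (simp add: block_sum_def[abs_def])
next
  case (Suc K)
  have "indep_var borel (block_sum L a K) borel (f (a + K * L) (a + K * L + L))"
    by (rule A_indep[OF block_sum_in f_in]) simp
  note variance_indep_add[OF sq_block_sum sq this]
  moreover have "block_sum L a (Suc K) = (\<lambda>x. block_sum L a K x + f (a + K * L) (a + K * L + L) x)"
    by (simp add: block_sum_def[abs_def])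
  ultimately show ?case by (simp only: Suc variance_stationary) (simp add: algebra_simps)
qed

lemma sdev_block_sum: "sdev (block_sum L a K) = sqrt K * sdev (f 0 L)"
  by (simp add: sdev_def variance_block_sum real_sqrt_mult)

text \<open>Halving the range splits the error into two independent errors, whose variances add,
  and one defect. At level \<open>i\<close> of the resulting binary tree the errors contribute
  a standard deviation of order \<open>sqrt (K / 2 ^ i)\<close>, which is summable in \<open>i\<close>; the
  correction \<open>- 4\<close> makes the induction go through.\<close>

lemma sdev_block_error:
  assumes "1 \<le> K"
  shows "sdev (\<lambda>x. f a (a + K * L) x - block_sum L a K x) \<le> C0 * (5 * sqrt K - 4)"
  using assms
proof (induction K arbitrary: a rule: less_induct)
  case (less K)
  show ?case
  proof (cases "K = 1")
    case True
    \<comment> \<open>A single block is its own block sum, so the error vanishes and the bound reads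
      \<open>C0\<close>.\<close>
    then show ?thesis using C0_nonneg by (simp add: block_sum_def sdev_def)
  next
    case False
    define K1 K2 where "K1 = K div 2" and "K2 = K - K div 2"
    have K: "K = K1 + K2" "K1 < K" "K2 < K" "1 \<le> K1" "1 \<le> K2"
      using False less.prems by (auto simp: K1_def K2_def)
    define R where "R = (\<lambda>a K x. f a (a + K * L) x - block_sum L a K x)"
    have R_sq: "square_integrable M (R a K)" for a K
      unfolding R_def by (intro square_integrable_diff sq sq_block_sum)
    have R_in: "R a K \<in> A a (a + K * L)" for a K
      unfolding R_def by (intro A_diff f_in block_sum_in) simp
    define b where "b = a + K1 * L"
    have ac: "a + K * L = b + K2 * L" by (simp add: b_def K(1) algebra_simps)
    define u v where "u = 5 * sqrt K1 - 4" and "v = 5 * sqrt K2 - 4"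
    have "1 \<le> sqrt K1" "1 \<le> sqrt K2" "1 \<le> sqrt K" using K by auto
    then have uv: "0 \<le> u" "0 \<le> v" "0 \<le> 5 * sqrt K - 5" unfolding u_def v_def by linarith+
    let ?S = "\<lambda>x. R a K1 x + R b K2 x"
    have "indep_var borel (R a K1) borel (R b K2)"
      unfolding b_def by (rule A_indep[OF R_in R_in])
    then have "(sdev ?S)\<^sup>2 = (sdev (R a K1))\<^sup>2 + (sdev (R b K2))\<^sup>2"
      unfolding sdev_squared by (rule variance_indep_add[OF R_sq R_sq])
    also have "\<dots> \<le> (C0 * u)\<^sup>2 + (C0 * v)\<^sup>2"
      using less.IH[of K1 a] less.IH[of K2 b] K
      by (intro add_mono power_mono sdev_nonneg) (auto simp: R_def u_def v_def)
    also have "\<dots> = C0\<^sup>2 * (u\<^sup>2 + v\<^sup>2)"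
      by (simp add: power_mult_distrib algebra_simps)
    \<comment> \<open>Aiming at \<open>- 5\<close> instead of \<open>- 4\<close> leaves exactly
      \<open>C0\<close> to pay for the defect at the middle cut.\<close>
    also have "\<dots> \<le> C0\<^sup>2 * (5 * sqrt K - 5)\<^sup>2"
    proof (rule mult_left_mono)
      have "50 * sqrt K + 7 \<le> 40 * (sqrt K1 + sqrt K2)"
        using sqrt_halving[of K] False less.prems by (simp add: K1_def K2_def)
      moreover have "real K = real K1 + real K2" using K by simp
      ultimately show "u\<^sup>2 + v\<^sup>2 \<le> (5 * sqrt K - 5)\<^sup>2"
        by (simp add: u_def v_def power2_diff power_mult_distrib)
    qed simp
    also have "\<dots> = (C0 * (5 * sqrt K - 5))\<^sup>2" by (simp only: power_mult_distrib)
    finally have S: "sdev ?S \<le> C0 * (5 * sqrt K - 5)"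
      by (rule power2_le_imp_le) (intro mult_nonneg_nonneg C0_nonneg uv(3))
    let ?g = "\<lambda>x. f a (a + K * L) x - f a b x - f b (a + K * L) x"
    have "R a K = (\<lambda>x. ?S x + ?g x)"
      using block_sum_add[of L a K1 K2] by (auto simp: R_def b_def K(1) algebra_simps)
    then have "sdev (R a K) \<le> sdev ?S + sdev ?g"
      using sdev_add_le[of ?S ?g] by (simp add: R_sq sq square_integrable_add square_integrable_diff)
    also have "\<dots> \<le> C0 * (5 * sqrt K - 5) + C0"
      using S defect[of a b "a + K * L"] by (intro add_mono) (auto simp: ac b_def)
    also have "\<dots> = C0 * (5 * sqrt K - 4)" by (simp add: algebra_simps)
    finally show ?thesis by (simp add: R_def)
  qed
qed

text \<open>The \<open>n mod L\<close> leftover columns and the cut before them cost a constant that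
  depends on \<open>L\<close> only, which disappears after division by
  \<open>sqrt n\<close>.\<close>

lemma sdev_block_approx:
  assumes "1 \<le> L" "L \<le> n"
  shows "sdev (\<lambda>x. f 0 n x - block_sum L 0 (n div L) x)
    \<le> 5 * C0 * sqrt (n div L) + (C0 + (\<Sum>r<L. sdev (f 0 r)))"
proof -
  define K where "K = n div L"
  have K: "1 \<le> K" using assms by (simp add: K_def Suc_le_eq div_greater_zero_iff)
  have n: "n = K * L + n mod L" by (simp add: K_def)
  let ?E = "\<lambda>x. f 0 (K * L) x - block_sum L 0 K x"
  let ?g = "\<lambda>x. f 0 n x - f 0 (K * L) x - f (K * L) n x"
  have "sdev (\<lambda>x. ?E x + (f (K * L) n x + ?g x)) \<le> sdev ?E + (sdev (f (K * L) n) + sdev ?g)"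
    by (rule order_trans[OF sdev_add_le add_left_mono[OF sdev_add_le]])
       (intro square_integrable_add square_integrable_diff sq sq_block_sum)+
  also have "\<dots> \<le> C0 * (5 * sqrt K - 4) + ((\<Sum>r<L. sdev (f 0 r)) + C0)"
  proof (intro add_mono)
    show "sdev ?E \<le> C0 * (5 * sqrt K - 4)" using sdev_block_error[OF K, of 0 L] by simp
    have "sdev (f (K * L) n) = sdev (f 0 (n mod L))"
      using sdev_stationary[of "K * L" "n mod L"] n by simp
    also have "\<dots> \<le> (\<Sum>r<L. sdev (f 0 r))"
      using assms by (intro member_le_sum) (auto simp: sdev_nonneg)
    finally show "sdev (f (K * L) n) \<le> (\<Sum>r<L. sdev (f 0 r))" .
    have "K * L \<le> n" using n by (metis le_add1)
    then show "sdev ?g \<le> C0" by (intro defect) auto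
  qed
  also have "\<dots> \<le> 5 * C0 * sqrt K + (C0 + (\<Sum>r<L. sdev (f 0 r)))"
    using C0_nonneg by (simp add: algebra_simps)
  finally show ?thesis by (simp add: K_def)
qed

section \<open>Convergence of the normalised standard deviations\<close>

lemma sqrt_div_tendsto:
  fixes L :: nat
  assumes "1 \<le> L"
  shows "(\<lambda>n. sqrt (n div L) / sqrt n) \<longlonglongrightarrow> 1 / sqrt L"
  using tendsto_real_sqrt[OF div_ratio_tendsto[of L]] assms by (simp add: real_sqrt_divide)

definition rate :: "nat \<Rightarrow> real" where
  "rate n = sdev (f 0 n) / sqrt n"

text \<open>Compares all late \<open>n\<close> with one fixed \<open>L\<close> without mentioning a
  limit, as a Cauchy argument requires.\<close>

lemma rate_approx:
  assumes "1 \<le> L" and e: "5 * C0 / sqrt L < e"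
  shows "\<forall>\<^sub>F n in sequentially. \<bar>rate n - rate L\<bar> < e"
proof -
  define W where "W = C0 + (\<Sum>r<L. sdev (f 0 r))"
  let ?q = "\<lambda>n. sqrt (n div L) / sqrt n"
  \<comment> \<open>Three errors: replacing \<open>f 0 n\<close> by blocks, the leftover columns,
    and \<open>n div L\<close> not being exactly \<open>n / L\<close>. Only the first survives in
    the limit, as \<open>5 * C0 / sqrt L\<close>.\<close>
  let ?b = "\<lambda>n. 5 * C0 * ?q n + W * (1 / sqrt n) + \<bar>?q n - 1 / sqrt L\<bar> * sdev (f 0 L)"
  have s0: "(\<lambda>n. 1 / sqrt (real n)) \<longlonglongrightarrow> 0"
    using tendsto_real_sqrt[OF lim_1_over_n] by (simp add: real_sqrt_divide)
  have "?b \<longlonglongrightarrow> 5 * C0 * (1 / sqrt L) + W * 0 + \<bar>1 / sqrt L - 1 / sqrt L\<bar> * sdev (f 0 L)"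
    by (intro tendsto_add tendsto_mult tendsto_rabs tendsto_diff tendsto_const sqrt_div_tendsto s0 assms)
  then have "\<forall>\<^sub>F n in sequentially. ?b n < e"
    by (rule order_tendstoD) (use e in simp)
  then show ?thesis
    using eventually_ge_at_top[of L]
  proof eventually_elim
    case (elim n)
    have n: "0 < sqrt n" using elim(2) assms by simp
    define K where "K = n div L"
    have "\<bar>sdev (f 0 n) - sqrt K * sdev (f 0 L)\<bar> \<le> sdev (\<lambda>x. f 0 n x - block_sum L 0 K x)"
      using sdev_diff_le[OF sq[of 0 n] sq_block_sum[of L 0 K]] by (simp add: sdev_block_sum)
    also have "\<dots> \<le> 5 * C0 * sqrt K + W"
      using sdev_block_approx[OF assms(1) elim(2)] by (simp add: K_def W_def)
    finally have "\<bar>sdev (f 0 n) - sqrt K * sdev (f 0 L)\<bar> / sqrt n \<le> (5 * C0 * sqrt K + W) / sqrt n"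
      using n by (intro divide_right_mono) auto
    also have "\<bar>sdev (f 0 n) - sqrt K * sdev (f 0 L)\<bar> / sqrt n = \<bar>rate n - ?q n * sdev (f 0 L)\<bar>"
    proof -
      have "rate n - ?q n * sdev (f 0 L) = (sdev (f 0 n) - sqrt K * sdev (f 0 L)) / sqrt n"
        by (simp add: rate_def K_def diff_divide_distrib)
      then show ?thesis using n by (simp only: abs_divide abs_of_pos)
    qed
    finally have 1: "\<bar>rate n - ?q n * sdev (f 0 L)\<bar> \<le> 5 * C0 * ?q n + W * (1 / sqrt n)"
      by (simp add: K_def add_divide_distrib)
    have "\<bar>?q n * sdev (f 0 L) - rate L\<bar> = \<bar>(?q n - 1 / sqrt L) * sdev (f 0 L)\<bar>"
      by (simp add: rate_def algebra_simps)
    also have "\<dots> = \<bar>?q n - 1 / sqrt L\<bar> * sdev (f 0 L)"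
      by (simp add: abs_mult sdev_nonneg)
    finally show ?case using 1 elim(1) by linarith
  qed
qed

lemma error_tendsto_0: "(\<lambda>L. c / sqrt (real L)) \<longlonglongrightarrow> 0"
  using tendsto_mult[OF tendsto_const[of c] tendsto_real_sqrt[OF lim_1_over_n]]
  by (simp add: real_sqrt_divide)

lemma rate_convergent: "convergent rate"
proof (rule Cauchy_convergent, rule metric_CauchyI)
  fix e :: real assume "0 < e"
  have "\<forall>\<^sub>F L in sequentially. 5 * C0 / sqrt (real L) < e / 2 \<and> 1 \<le> L"
    using order_tendstoD(2)[OF error_tendsto_0[of "5 * C0"], of "e / 2"] \<open>0 < e\<close> eventually_ge_at_top[of 1]
    by (auto intro: eventually_conj)
  then obtain L where L: "5 * C0 / sqrt (real L) < e / 2" "1 \<le> L"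
    by (metis (mono_tags, lifting) eventually_sequentially order_refl)
  from rate_approx[OF L(2,1)] obtain N where N: "\<And>n. N \<le> n \<Longrightarrow> \<bar>rate n - rate L\<bar> < e / 2"
    unfolding eventually_sequentially by blast
  show "\<exists>N. \<forall>m\<ge>N. \<forall>n\<ge>N. dist (rate m) (rate n) < e"
  proof (intro exI[of _ N] allI impI)
    fix m n assume "N \<le> m" "N \<le> n"
    with N[of m] N[of n] show "dist (rate m) (rate n) < e"
      unfolding dist_real_def by linarith
  qed
qed

end

section \<open>Characteristic functions of centred Gaussian laws\<close>

lemma gaussian_law_eq_distr:
  assumes "0 < s"
  shows "gaussian_law 0 s = distr std_normal_distribution borel (\<lambda>x. s * x)"
proof -
  have S: "prob_space std_normal_distribution"
    using prob_space_normal_density[of 1 0] by simp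
  interpret prob_space std_normal_distribution by fact
  have "distributed std_normal_distribution lborel (\<lambda>x. x) (normal_density 0 1)"
    by (auto simp: distributed_def distr_id2)
  from normal_density_affine[OF this, of s 0] assms
  have "distributed std_normal_distribution lborel (\<lambda>x. s * x) (normal_density 0 s)" by simp
  then have "distr std_normal_distribution lborel (\<lambda>x. s * x) = gaussian_law 0 s"
    by (simp add: distributed_def gaussian_law_def)
  moreover have "distr std_normal_distribution lborel (\<lambda>x. s * x) = distr std_normal_distribution borel (\<lambda>x. s * x)"
    by (rule distr_cong) auto
  ultimately show ?thesis by simp
qed

lemma char_gaussian_law:
  assumes "0 < s"
  shows "char (gaussian_law 0 s) t = complex_of_real (exp (- (s * t)\<^sup>2 / 2))"
proof -
  have "char (gaussian_law 0 s) t = char std_normal_distribution (s * t)"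
    by (simp add: gaussian_law_eq_distr[OF assms] char_def integral_distr mult_ac)
  then show ?thesis by (simp add: char_std_normal_distribution)
qed

lemma real_distribution_gaussian_law: "0 < s \<Longrightarrow> real_distribution (gaussian_law 0 s)"
proof -
  assume "0 < s"
  interpret real_distribution std_normal_distribution by (rule real_dist_normal_dist)
  show ?thesis
    unfolding gaussian_law_eq_distr[OF \<open>0 < s\<close>] by (rule real_distribution_distr) simp
qed

section \<open>Passage from blocks to the full process\<close>

context near_additive_process
begin

lemma block_sum_clt:
  assumes L: "0 < sdev (f 0 L)" "1 \<le> L"
  shows "(\<lambda>K. char (distr M borel (\<lambda>x. (block_sum L 0 K x - expectation (block_sum L 0 K)) / sqrt (real (K * L)))) t)
    \<longlonglongrightarrow> complex_of_real (exp (- (rate L * t)\<^sup>2 / 2))"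
proof -
  define v where "v = sdev (f 0 L)"
  define m where "m = expectation (f 0 L)"
  define Y where "Y = (\<lambda>K x. (\<Sum>i<K. f (i * L) (i * L + L) x - m) / sqrt (K * v\<^sup>2))"
  have Y_meas [measurable]: "Y K \<in> borel_measurable M" for K by (simp add: Y_def)
  have "weak_conv_m (\<lambda>K. distr M borel (Y K)) std_normal_distribution"
    unfolding Y_def
  proof (rule central_limit_theorem)
    show "indep_vars (\<lambda>_. borel) (\<lambda>k. f (k * L) (k * L + L)) UNIV" by (rule indep_blocks)
    show "expectation (f (k * L) (k * L + L)) = m" for k
      by (simp add: expectation_stationary m_def)
    show "0 < v" using L by (simp add: v_def)
    show "integrable M (\<lambda>x. (f (k * L) (k * L + L) x)\<^sup>2)" for k
      using sq by (rule square_integrableD)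
    show "variance (f (k * L) (k * L + L)) = v\<^sup>2" for k
      by (simp add: v_def sdev_squared variance_stationary)
    show "distr M borel (f (k * L) (k * L + L)) = distr M borel (f 0 L)" for k
      by (rule stationary)
  qed
  \<comment> \<open>\<open>rate L * Y K\<close> is the centred block sum over
    \<open>sqrt (K * L)\<close>, so evaluation at \<open>rate L * t\<close> does the change of
    normalisation.\<close>
  then have lim: "(\<lambda>K. char (distr M borel (Y K)) (rate L * t)) \<longlonglongrightarrow> char std_normal_distribution (rate L * t)"
    by (intro levy_continuity1 real_dist_normal_dist) (auto intro!: real_distribution_distr)
  have char_distr: "char (distr M borel Z) u = (CLINT x|M. iexp (u * Z x))"
    if "Z \<in> borel_measurable M" for Z u
    unfolding char_def by (rule integral_distr) (use that in simp_all)
  have "char (distr M borel (Y K)) (rate L * t)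
      = char (distr M borel (\<lambda>x. (block_sum L 0 K x - expectation (block_sum L 0 K)) / sqrt (real (K * L)))) t" for K
  proof -
    have e: "expectation (block_sum L 0 K) = K * m"
      unfolding block_sum_def using square_integrableD(3)[OF sq]
      by (simp add: expectation_stationary m_def)
    have "rate L * t * Y K x = t * ((block_sum L 0 K x - expectation (block_sum L 0 K)) / sqrt (real (K * L)))" for x
      using L by (simp add: e Y_def rate_def block_sum_def sum_subtractf real_sqrt_mult v_def[symmetric])
    moreover have "(\<lambda>x. (block_sum L 0 K x - expectation (block_sum L 0 K)) / sqrt (real (K * L))) \<in> borel_measurable M"
      using square_integrableD(1)[OF sq_block_sum] by simp
    ultimately show ?thesis by (simp only: char_distr Y_meas)
  qed
  with lim show ?thesis by (simp add: char_std_normal_distribution)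
qed

text \<open>\<open>L\<close> is fixed before \<open>n\<close> grows. The errors \<open>X n\<close>
  against blocks, blocks against the Gaussian with parameter \<open>rate L\<close>, and
  \<open>rate L\<close> against its limit take \<open>e / 3\<close> each. \<open>growth\<close>
  excludes a degenerate limit; it starts at \<open>n = 2\<close> because with constant vertex
  weights and no edges in \<open>H\<close> a single column is deterministic.\<close>

theorem central_limit:
  assumes c: "0 < c" and growth: "\<And>n. 2 \<le> n \<Longrightarrow> c * real n \<le> variance (f 0 n)"
  shows "\<exists>\<sigma>>0. (\<lambda>n. variance (f 0 n) / real n) \<longlonglongrightarrow> \<sigma>\<^sup>2 \<and>
    weak_conv_m (\<lambda>n. distr M borel (\<lambda>x. (f 0 n x - expectation (f 0 n)) / sqrt (real n))) (gaussian_law 0 \<sigma>)"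
proof -
  obtain \<sigma> where \<sigma>: "rate \<longlonglongrightarrow> \<sigma>" using rate_convergent by (auto simp: convergent_def)
  have rate_sq: "(rate n)\<^sup>2 = variance (f 0 n) / real n" for n
    by (simp add: rate_def power_divide sdev_squared)
  have rate_ge: "sqrt c \<le> rate n" if "2 \<le> n" for n
  proof -
    have "c \<le> (rate n)\<^sup>2" unfolding rate_sq using growth[OF that] that by (simp add: field_simps)
    then show ?thesis by (rule real_le_lsqrt[rotated]) (simp add: rate_def sdev_nonneg)
  qed
  have "sqrt c \<le> \<sigma>"
    by (rule LIMSEQ_le_const[OF \<sigma>]) (use rate_ge in blast)
  then have \<sigma>_pos: "0 < \<sigma>" using c by (meson less_le_trans real_sqrt_gt_zero)
  define X where "X = (\<lambda>n x. (f 0 n x - expectation (f 0 n)) / sqrt (real n))"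
  have X_meas [measurable]: "X n \<in> borel_measurable M" for n by (simp add: X_def)
  have "(\<lambda>n. char (distr M borel (X n)) t) \<longlonglongrightarrow> char (gaussian_law 0 \<sigma>) t" for t
  proof (rule metric_LIMSEQ_I)
    fix e :: real assume "0 < e"
    let ?G = "\<lambda>s. complex_of_real (exp (- (s * t)\<^sup>2 / 2))"
    have "(\<lambda>L. ?G (rate L)) \<longlonglongrightarrow> ?G \<sigma>" by (intro tendsto_intros \<sigma>) simp
    then have "\<forall>\<^sub>F L in sequentially. dist (?G (rate L)) (?G \<sigma>) < e / 3"
      using \<open>0 < e\<close> by (intro tendstoD) simp_all
    moreover have "\<forall>\<^sub>F L in sequentially. \<bar>t\<bar> * 5 * C0 / sqrt (real L) < e / 3"
      using order_tendstoD(2)[OF error_tendsto_0] \<open>0 < e\<close> by simp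
    \<comment> \<open>\<open>2 \<le> L\<close> lets \<open>growth\<close> make \<open>rate L\<close>
      positive, as \<open>block_sum_clt\<close> requires.\<close>
    ultimately have "\<forall>\<^sub>F L in sequentially. dist (?G (rate L)) (?G \<sigma>) < e / 3 \<and>
        \<bar>t\<bar> * 5 * C0 / sqrt (real L) < e / 3 \<and> 2 \<le> L"
      using eventually_ge_at_top[of 2] by eventually_elim simp
    then obtain L where L: "dist (?G (rate L)) (?G \<sigma>) < e / 3"
        "\<bar>t\<bar> * 5 * C0 / sqrt (real L) < e / 3" "2 \<le> L"
      unfolding eventually_sequentially by blast
    have "0 < rate L" using rate_ge[OF L(3)] c by (meson less_le_trans real_sqrt_gt_zero)
    then have sdev_L: "0 < sdev (f 0 L)" using sdev_nonneg[of "f 0 L"] by (auto simp: rate_def zero_less_divide_iff)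
    define Y where "Y = (\<lambda>K x. (block_sum L 0 K x - expectation (block_sum L 0 K)) / sqrt (real (K * L)))"
    have Y_meas [measurable]: "Y K \<in> borel_measurable M" for K
      using square_integrableD(1)[OF sq_block_sum] by (simp add: Y_def)
    have "filterlim (\<lambda>n. n div L) sequentially sequentially"
      unfolding filterlim_at_top
    proof (intro allI)
      fix Z :: nat
      show "\<forall>\<^sub>F n in sequentially. Z \<le> n div L"
        using eventually_ge_at_top[of "Z * L"]
        by eventually_elim (use L(3) in \<open>simp add: less_eq_div_iff_mult_less_eq\<close>)
    qed
    from tendstoD[OF filterlim_compose[OF block_sum_clt[OF sdev_L, of t] this], of "e / 3"] \<open>0 < e\<close> L(3)
    have Y_conv: "\<forall>\<^sub>F n in sequentially. dist (char (distr M borel (Y (n div L))) t) (?G (rate L)) < e / 3"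
      by (simp add: Y_def)
    define W where "W = C0 + (\<Sum>r<L. sdev (f 0 r))"
    let ?q = "\<lambda>n. sqrt (n div L) / sqrt n"
    \<comment> \<open>The same error budget as in \<open>rate_approx\<close>.\<close>
    let ?b = "\<lambda>n. 5 * C0 * ?q n + W * (1 / sqrt n) + \<bar>?q n - 1 / sqrt L\<bar> * sdev (f 0 L)"
    have s0: "(\<lambda>n. 1 / sqrt (real n)) \<longlonglongrightarrow> 0"
      by (rule error_tendsto_0)
    have "(\<lambda>n. \<bar>t\<bar> * ?b n) \<longlonglongrightarrow> \<bar>t\<bar> * (5 * C0 * (1 / sqrt L) + W * 0 + \<bar>1 / sqrt L - 1 / sqrt L\<bar> * sdev (f 0 L))"
      by (intro tendsto_add tendsto_mult tendsto_rabs tendsto_diff tendsto_const sqrt_div_tendsto s0)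
        (use L(3) in linarith)+
    then have "\<forall>\<^sub>F n in sequentially. \<bar>t\<bar> * ?b n < e / 3"
      by (rule order_tendstoD) (use L(2) in \<open>simp add: mult.assoc\<close>)
    then have "\<forall>\<^sub>F n in sequentially. dist (char (distr M borel (X n)) t) (char (gaussian_law 0 \<sigma>) t) < e"
      using Y_conv eventually_ge_at_top[of L]
    proof eventually_elim
      case (elim n)
      define K where "K = n div L"
      have n: "0 < sqrt n" and K: "0 < sqrt K"
        using elim(3) L(3) by (auto simp: K_def div_greater_zero_iff)
      let ?D = "\<lambda>x. f 0 n x - block_sum L 0 K x"
      \<comment> \<open>\<open>X n\<close> is normalised by \<open>sqrt n\<close> and
        \<open>Y K\<close> by \<open>sqrt (K * L)\<close>; \<open>?d\<close> is the
        mismatch.\<close>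
      let ?d = "1 / sqrt n - 1 / sqrt (real (K * L))"
      have D: "square_integrable M ?D" by (intro square_integrable_diff sq sq_block_sum)
      let ?Z = "\<lambda>x. (1 / sqrt n) * ?D x + ?d * block_sum L 0 K x"
      have Z: "square_integrable M ?Z"
        by (intro square_integrable_add square_integrable_cmult D sq_block_sum)
      have int: "integrable M (f 0 n)" "integrable M (block_sum L 0 K)"
        using square_integrableD(3)[OF sq] square_integrableD(3)[OF sq_block_sum] by auto
      have "expectation ?Z = (1 / sqrt n) * (expectation (f 0 n) - expectation (block_sum L 0 K))
          + ?d * expectation (block_sum L 0 K)"
        using int by simp
      then have XY: "X n x - Y K x = ?Z x - expectation ?Z" for x
        by (simp add: X_def Y_def left_diff_distrib diff_divide_distrib)
      have "cmod (char (distr M borel (X n)) t - char (distr M borel (Y K)) t)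
          \<le> \<bar>t\<bar> * expectation (\<lambda>x. \<bar>X n x - Y K x\<bar>)"
        by (rule char_diff_le) (use square_integrableD(3)[OF Z] in \<open>simp_all add: XY\<close>)
      also have "\<dots> \<le> \<bar>t\<bar> * sdev ?Z"
        unfolding XY by (intro mult_left_mono expectation_abs_le_sdev Z) simp
      also have "\<dots> \<le> \<bar>t\<bar> * ?b n"
      proof (rule mult_left_mono)
        have "sdev ?Z \<le> sdev (\<lambda>x. (1 / sqrt n) * ?D x) + sdev (\<lambda>x. ?d * block_sum L 0 K x)"
          by (intro sdev_add_le square_integrable_cmult D sq_block_sum)
        also have "\<dots> = (1 / sqrt n) * sdev ?D + \<bar>?d\<bar> * (sqrt K * sdev (f 0 L))"
          unfolding sdev_cmult sdev_block_sum using n by simp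
        also have "\<dots> \<le> (1 / sqrt n) * (5 * C0 * sqrt K + W) + \<bar>?d\<bar> * (sqrt K * sdev (f 0 L))"
          using sdev_block_approx[of L n] elim(3) L(3) n
          by (intro add_right_mono mult_left_mono) (simp_all add: K_def W_def)
        also have "\<bar>?d\<bar> * (sqrt K * sdev (f 0 L)) = \<bar>?d * sqrt K\<bar> * sdev (f 0 L)"
          by (simp add: abs_mult)
        also have "?d * sqrt K = ?q n - 1 / sqrt L"
          using K n by (simp add: K_def[symmetric] real_sqrt_mult left_diff_distrib)
        finally show "sdev ?Z \<le> ?b n"
          by (simp add: K_def[symmetric] add_divide_distrib)
      qed simp
      also have "\<dots> < e / 3" by (rule elim(1))
      finally have "dist (char (distr M borel (X n)) t) (char (distr M borel (Y K)) t) < e / 3"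
        by (simp only: dist_norm)
      then show ?case
        using elim(2) L(1) unfolding char_gaussian_law[OF \<sigma>_pos] K_def
        by (rule dist_triangle_third)
    qed
    then show "\<exists>no. \<forall>n\<ge>no. dist (char (distr M borel (X n)) t) (char (gaussian_law 0 \<sigma>) t) < e"
      by (simp add: eventually_sequentially)
  qed
  then have "weak_conv_m (\<lambda>n. distr M borel (X n)) (gaussian_law 0 \<sigma>)"
    by (intro levy_continuity real_distribution_gaussian_law[OF \<sigma>_pos] real_distribution_distr) simp_all
  moreover have "(\<lambda>n. variance (f 0 n) / real n) \<longlonglongrightarrow> \<sigma>\<^sup>2"
    unfolding rate_sq[symmetric] by (intro tendsto_power \<sigma>)
  ultimately show ?thesis using \<sigma>_pos unfolding X_def by blast
qed

end

section \<open>Partition functions of finite graphs\<close>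

lemma disjoint_subset: "disjoint m \<Longrightarrow> m' \<subseteq> m \<Longrightarrow> disjoint m'"
  by (rule pairwise_subset)

lemma finite_matchings: "finite E \<Longrightarrow> finite (matchings E)"
  by (rule finite_subset[of _ "Pow E"]) (auto simp: matchings_def)

lemma empty_in_matchings: "{} \<in> matchings E"
  by (simp add: matchings_def)

lemma matchings_mono: "E0 \<subseteq> E \<Longrightarrow> matchings E0 \<subseteq> matchings E"
  by (auto simp: matchings_def)

lemma partition_fn_pos:
  assumes "finite E" shows "0 < partition_fn W E nu om"
  unfolding partition_fn_def using finite_matchings[OF assms] empty_in_matchings
  by (intro sum_pos) auto

lemma partition_fn_mono:
  assumes "finite E" "E0 \<subseteq> E"
  shows "partition_fn W E0 nu om \<le> partition_fn W E nu om"
  unfolding partition_fn_def using assms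
  by (intro sum_mono2 finite_matchings matchings_mono) auto

lemma partition_fn_cong:
  assumes "\<And>v. v \<in> W \<Longrightarrow> nu v = nu' v" "\<And>e. e \<in> E \<Longrightarrow> om e = om' e"
  shows "partition_fn W E nu om = partition_fn W E nu' om'"
  unfolding partition_fn_def hamiltonian_def using assms
  by (intro sum.cong arg_cong[of _ _ exp] arg_cong2[of _ _ _ _ "(+)"]) (auto simp: matchings_def)

lemma partition_fn_no_edges:
  fixes W :: "'v set"
  shows "partition_fn W {} nu om = exp (\<Sum>v\<in>W. nu v)"
proof -
  have "matchings {} = ({{}} :: 'v set set set)" by (auto simp: matchings_def)
  then show ?thesis by (simp add: partition_fn_def hamiltonian_def)
qed

text \<open>No edge of \<open>E\<close> touches \<open>t\<close>, so every matching leaves these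
  vertices uncovered and their weights factor out.\<close>

lemma partition_fn_isolated:
  assumes "finite W" "t \<subseteq> W" "t \<inter> \<Union>E = {}"
  shows "partition_fn W E nu om = exp (\<Sum>v\<in>t. nu v) * partition_fn (W - t) E nu om"
proof -
  have "hamiltonian W nu om m = (\<Sum>v\<in>t. nu v) + hamiltonian (W - t) nu om m" if "m \<in> matchings E" for m
  proof -
    have "W - \<Union>m = t \<union> (W - t - \<Union>m)" using that assms by (auto simp: matchings_def)
    moreover have "(\<Sum>v\<in>t \<union> (W - t - \<Union>m). nu v) = (\<Sum>v\<in>t. nu v) + (\<Sum>v\<in>W - t - \<Union>m. nu v)"
      using assms by (intro sum.union_disjoint) (auto intro: finite_subset)
    ultimately show ?thesis by (simp add: hamiltonian_def)
  qed
  then show ?thesis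
    unfolding partition_fn_def sum_distrib_left by (intro sum.cong) (auto simp: exp_add)
qed

text \<open>Deletion recursion: a matching that contains \<open>e\<close> is \<open>e\<close>
  together with a matching of the edges that miss \<open>e\<close>.\<close>

lemma partition_fn_insert:
  assumes "finite E" "e \<notin> E" "e \<noteq> {}"
  shows "partition_fn W (insert e E) nu om
    = partition_fn W E nu om + exp (om e) * partition_fn (W - e) {e' \<in> E. e' \<inter> e = {}} nu om"
proof -
  let ?E = "{e' \<in> E. e' \<inter> e = {}}"
  have "matchings (insert e E) \<subseteq> matchings E \<union> insert e ` matchings ?E"
  proof
    fix m assume m: "m \<in> matchings (insert e E)"
    show "m \<in> matchings E \<union> insert e ` matchings ?E"
    proof (cases "e \<in> m")
      case False
      then show ?thesis using m by (auto simp: matchings_def)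
    next
      case True
      then have "m - {e} \<in> matchings ?E"
        using m by (auto simp: matchings_def intro: disjoint_subset dest: disjointD)
      moreover have "m = insert e (m - {e})" using True by blast
      ultimately show ?thesis by blast
    qed
  qed
  moreover have "insert e m \<in> matchings (insert e E)" if "m \<in> matchings ?E" for m
    using that unfolding matchings_def disjoint_def by fastforce
  ultimately have split: "matchings (insert e E) = matchings E \<union> insert e ` matchings ?E"
    using matchings_mono[of E "insert e E"] by blast
  have not_in: "e \<notin> m" if "m \<in> matchings ?E" for m
    using that assms by (auto simp: matchings_def)
  have "inj_on (insert e) (matchings ?E)"
    by (rule inj_onI) (use not_in in \<open>metis insert_ident\<close>)
  moreover have "hamiltonian W nu om (insert e m) = om e + hamiltonian (W - e) nu om m" if "m \<in> matchings ?E" for m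
  proof -
    have "finite m" using that assms(1) by (auto simp: matchings_def intro: finite_subset)
    moreover have "W - \<Union>(insert e m) = W - e - \<Union>m" by auto
    ultimately show ?thesis using not_in[OF that] by (simp add: hamiltonian_def del: Union_insert)
  qed
  ultimately have "(\<Sum>m\<in>insert e ` matchings ?E. exp (hamiltonian W nu om m))
      = exp (om e) * partition_fn (W - e) ?E nu om"
    by (simp add: sum.reindex partition_fn_def sum_distrib_left exp_add)
  moreover have "matchings E \<inter> insert e ` matchings ?E = {}"
    using assms by (auto simp: matchings_def)
  ultimately show ?thesis
    unfolding partition_fn_def split using assms
    by (subst sum.union_disjoint) (auto simp: finite_matchings)
qed

text \<open>Bounds the logarithm of \<open>1 + exp (om e - (\<Sum>v\<in>e. nu v))\<close>, the
  largest factor by which adding \<open>e\<close> can enlarge the partition function;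
  \<open>ln 2\<close> accounts for the two summands.\<close>

definition edge_bound :: "('v \<Rightarrow> real) \<Rightarrow> ('v set \<Rightarrow> real) \<Rightarrow> 'v set \<Rightarrow> real" where
  "edge_bound nu om e = ln 2 + \<bar>om e\<bar> + (\<Sum>v\<in>e. \<bar>nu v\<bar>)"

lemma edge_bound_nonneg: "0 \<le> edge_bound nu om e"
  by (simp add: edge_bound_def sum_nonneg)

text \<open>A matching that uses \<open>e\<close> is compared with the one that drops
  \<open>e\<close> and uncovers its endpoints: the edge weight is traded for the vertex weights on
  \<open>e\<close>.\<close>

lemma partition_fn_insert_le:
  assumes "finite W" "finite E" "e \<subseteq> W" "e \<noteq> {}"
  shows "partition_fn W (insert e E) nu om \<le> partition_fn W E nu om * exp (edge_bound nu om e)"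
proof (cases "e \<in> E")
  case True
  then show ?thesis
    using edge_bound_nonneg[of nu om e] partition_fn_pos[OF assms(2), of W nu om]
    by (simp add: insert_absorb)
next
  case False
  let ?E = "{e' \<in> E. e' \<inter> e = {}}" and ?s = "\<Sum>v\<in>e. nu v"
  have Z: "0 < partition_fn W E nu om" by (rule partition_fn_pos[OF assms(2)])
  have "exp ?s * partition_fn (W - e) ?E nu om = partition_fn W ?E nu om"
    using assms by (intro partition_fn_isolated[symmetric]) auto
  also have "\<dots> \<le> partition_fn W E nu om"
    using assms by (intro partition_fn_mono) auto
  finally have Y: "exp (om e) * partition_fn (W - e) ?E nu om \<le> exp (om e - ?s) * partition_fn W E nu om"
    by (simp add: exp_diff field_simps)
  have "\<bar>?s\<bar> \<le> (\<Sum>v\<in>e. \<bar>nu v\<bar>)" by (rule sum_abs)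
  then have "om e - ?s \<le> \<bar>om e\<bar> + (\<Sum>v\<in>e. \<bar>nu v\<bar>)" by linarith
  then have "1 + exp (om e - ?s) \<le> exp (\<bar>om e\<bar> + (\<Sum>v\<in>e. \<bar>nu v\<bar>)) + exp (\<bar>om e\<bar> + (\<Sum>v\<in>e. \<bar>nu v\<bar>))"
    by (intro add_mono) (simp_all add: sum_nonneg)
  also have "\<dots> = exp (edge_bound nu om e)" by (simp add: edge_bound_def exp_add)
  finally have "partition_fn W E nu om * (1 + exp (om e - ?s)) \<le> partition_fn W E nu om * exp (edge_bound nu om e)"
    using Z by simp
  then show ?thesis
    using Y by (simp add: partition_fn_insert[OF assms(2) False assms(4)] algebra_simps)
qed

lemma partition_fn_le:
  assumes "finite W" "finite E" "E0 \<subseteq> E" "\<And>e. e \<in> E \<Longrightarrow> e \<subseteq> W \<and> e \<noteq> {}"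
  shows "partition_fn W E nu om \<le> partition_fn W E0 nu om * exp (\<Sum>e\<in>E - E0. edge_bound nu om e)"
proof -
  have "partition_fn W (E0 \<union> C) nu om \<le> partition_fn W E0 nu om * exp (\<Sum>e\<in>C. edge_bound nu om e)"
    if "C \<subseteq> E" for C
    using finite_subset[OF that assms(2)] that
  proof (induction C rule: finite_induct)
    case (insert e C)
    have "partition_fn W (E0 \<union> insert e C) nu om \<le> partition_fn W (E0 \<union> C) nu om * exp (edge_bound nu om e)"
      using partition_fn_insert_le[of W "E0 \<union> C" e] assms insert.prems insert.hyps(1)
      by (auto dest: finite_subset)
    also have "\<dots> \<le> partition_fn W E0 nu om * exp (\<Sum>e\<in>C. edge_bound nu om e) * exp (edge_bound nu om e)"
      using insert.IH insert.prems by (intro mult_right_mono) auto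
    also have "\<dots> = partition_fn W E0 nu om * exp (\<Sum>e\<in>insert e C. edge_bound nu om e)"
      using insert.hyps by (simp add: exp_add mult_ac)
    finally show ?case .
  qed simp
  from this[of "E - E0"] show ?thesis using assms(3) by (simp add: Un_absorb1)
qed

text \<open>Applied to the edges that cross a cut, this is the two-sided bound on the
  defect.\<close>

lemma ln_partition_fn_diff:
  assumes "finite W" "finite E" "E0 \<subseteq> E" "\<And>e. e \<in> E \<Longrightarrow> e \<subseteq> W \<and> e \<noteq> {}"
  shows "0 \<le> ln (partition_fn W E nu om) - ln (partition_fn W E0 nu om)"
    and "ln (partition_fn W E nu om) - ln (partition_fn W E0 nu om) \<le> (\<Sum>e\<in>E - E0. edge_bound nu om e)"
proof -
  have pos: "0 < partition_fn W E nu om" "0 < partition_fn W E0 nu om"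
    using assms by (auto intro!: partition_fn_pos dest: finite_subset)
  show "0 \<le> ln (partition_fn W E nu om) - ln (partition_fn W E0 nu om)"
    using partition_fn_mono[OF assms(2,3)] pos by simp
  have "ln (partition_fn W E nu om) \<le> ln (partition_fn W E0 nu om * exp (\<Sum>e\<in>E - E0. edge_bound nu om e))"
    using partition_fn_le[OF assms] pos by simp
  then show "ln (partition_fn W E nu om) - ln (partition_fn W E0 nu om) \<le> (\<Sum>e\<in>E - E0. edge_bound nu om e)"
    using pos by (simp add: ln_mult)
qed

lemma partition_fn_disjoint_union:
  assumes "finite W1" "finite E1" "finite W2" "finite E2" "W1 \<inter> W2 = {}"
    "\<And>e. e \<in> E1 \<Longrightarrow> e \<subseteq> W1" "\<And>e. e \<in> E2 \<Longrightarrow> e \<subseteq> W2 \<and> e \<noteq> {}"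
  shows "partition_fn (W1 \<union> W2) (E1 \<union> E2) nu om = partition_fn W1 E1 nu om * partition_fn W2 E2 nu om"
  using assms(4,3,5,7)
\<comment> \<open>The deletion recursion leads both to \<open>E2 - {e}\<close> and to its part
  disjoint from \<open>e\<close>, hence induction over strict subsets; \<open>W2\<close> varies
  because \<open>e\<close> is removed from it.\<close>
proof (induction E2 arbitrary: W2 rule: finite_psubset_induct)
  case (psubset E2)
  show ?case
  proof (cases "E2 = {}")
    case True
    have "partition_fn (W1 \<union> W2) E1 nu om = exp (\<Sum>v\<in>W2. nu v) * partition_fn (W1 \<union> W2 - W2) E1 nu om"
      using assms psubset.prems by (intro partition_fn_isolated) blast+
    moreover have "W1 \<union> W2 - W2 = W1" using psubset.prems by blast
    ultimately show ?thesis using True by (simp add: partition_fn_no_edges)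
  next
    case False
    then obtain e where e: "e \<in> E2" by blast
    define F where "F = E2 - {e}"
    have F: "E2 = insert e F" "e \<notin> F" "F \<subset> E2" "finite F"
      using e psubset.hyps by (auto simp: F_def)
    have eW: "e \<subseteq> W2" "e \<noteq> {}" using e psubset.prems by auto
    have "e \<notin> E1 \<union> F" using F eW psubset.prems(2) assms(6) by blast
    then have "partition_fn (W1 \<union> W2) (insert e (E1 \<union> F)) nu om = partition_fn (W1 \<union> W2) (E1 \<union> F) nu om
        + exp (om e) * partition_fn (W1 \<union> W2 - e) {e' \<in> E1 \<union> F. e' \<inter> e = {}} nu om"
      using assms F eW by (intro partition_fn_insert) auto
    also have "W1 \<union> W2 - e = W1 \<union> (W2 - e)" using eW psubset.prems by blast
    also have "{e' \<in> E1 \<union> F. e' \<inter> e = {}} = E1 \<union> {e' \<in> F. e' \<inter> e = {}}"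
      using eW psubset.prems(2) assms(6) by blast
    also have "partition_fn (W1 \<union> W2) (E1 \<union> F) nu om = partition_fn W1 E1 nu om * partition_fn W2 F nu om"
      using psubset.prems F by (intro psubset.IH) auto
    also have "partition_fn (W1 \<union> (W2 - e)) (E1 \<union> {e' \<in> F. e' \<inter> e = {}}) nu om
        = partition_fn W1 E1 nu om * partition_fn (W2 - e) {e' \<in> F. e' \<inter> e = {}} nu om"
    proof (rule psubset.IH)
      show "{e' \<in> F. e' \<inter> e = {}} \<subset> E2" using F by auto
      show "e' \<subseteq> W2 - e \<and> e' \<noteq> {}" if "e' \<in> {e' \<in> F. e' \<inter> e = {}}" for e'
        using that psubset.prems(3)[of e'] F by auto
    qed (use psubset.prems in auto)
    finally show ?thesis
      using F eW by (simp add: partition_fn_insert algebra_simps)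
  qed
qed

lemma partition_fn_image:
  assumes "inj \<phi>"
  shows "partition_fn (\<phi> ` W) ((`) \<phi> ` E) nu om = partition_fn W E (\<lambda>v. nu (\<phi> v)) (\<lambda>e. om (\<phi> ` e))"
proof -
  have inj1: "inj ((`) \<phi>)" and inj2: "inj ((`) ((`) \<phi>))"
    using assms by (auto simp: inj_on_image inj_image_eq_iff intro!: injI)
  have disj: "disjoint ((`) \<phi> ` m) \<longleftrightarrow> disjoint m" for m
    using assms by (auto simp: disjoint_def inj_image_eq_iff image_Int[OF assms, symmetric])
  have "matchings ((`) \<phi> ` E) = (`) ((`) \<phi>) ` matchings E"
    by (auto simp: matchings_def subset_image_iff disj)
  moreover have "hamiltonian (\<phi> ` W) nu om ((`) \<phi> ` m) = hamiltonian W (\<lambda>v. nu (\<phi> v)) (\<lambda>e. om (\<phi> ` e)) m" for m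
  proof -
    have "\<phi> ` W - \<Union>((`) \<phi> ` m) = \<phi> ` (W - \<Union>m)"
      using assms by (auto simp: inj_image_mem_iff dest: injD)
    then show ?thesis
      using inj_on_subset[OF assms] inj_on_subset[OF inj1]
      by (simp add: hamiltonian_def sum.reindex)
  qed
  ultimately show ?thesis
    using inj_on_subset[OF inj2] by (simp add: partition_fn_def sum.reindex)
qed

text \<open>All weights form one function on a sum type, so that a single product measure can carry
  them.\<close>

definition ln_Z :: "'v set \<Rightarrow> 'v set set \<Rightarrow> ('v + 'v set \<Rightarrow> real) \<Rightarrow> real" where
  "ln_Z W E w = ln (partition_fn W E (\<lambda>v. w (Inl v)) (\<lambda>e. w (Inr e)))"

definition weight_bound :: "('v + 'v set \<Rightarrow> real) \<Rightarrow> 'v set \<Rightarrow> real" where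
  "weight_bound w e = edge_bound (\<lambda>v. w (Inl v)) (\<lambda>e. w (Inr e)) e"

fun endpoints :: "'v + 'v set \<Rightarrow> 'v set" where
  "endpoints (Inl v) = {v}"
| "endpoints (Inr e) = e"

text \<open>The weight at \<open>k\<close> enters the Hamiltonian of a matching once or not at all:
  \<open>B\<close> collects the matchings where it enters, \<open>A\<close> the others. Deleting all
  edges at the endpoints of \<open>k\<close> bounds \<open>A\<close> by a multiple of
  \<open>B\<close>, at a price that only the edges near \<open>k\<close> determine.\<close>

lemma partition_fn_affine:
  assumes W: "finite W" and E: "finite E" "\<And>e. e \<in> E \<Longrightarrow> e \<subseteq> W \<and> e \<noteq> {}" and k: "k \<in> W <+> E"
  obtains A B where "0 \<le> A" "0 < B"
    "A \<le> B * exp (\<Sum>e | e \<in> E \<and> e \<inter> endpoints k \<noteq> {}. weight_bound w e)"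
    "\<And>x. ln_Z W E (w(k := x)) = ln (A + B * exp x)"
proof (cases k)
  case (Inl v)
  then have v: "v \<in> W" using k by auto
  define E' where "E' = {e \<in> E. v \<notin> e}"
  define nu om where "nu = (\<lambda>v. w (Inl v))" and "om = (\<lambda>e. w (Inr e))"
  define A where "A = (\<Sum>m\<in>matchings E - matchings E'. exp (hamiltonian W nu om m))"
  define B where "B = partition_fn (W - {v}) E' nu om"
  have fin: "finite E'" using E by (simp add: E'_def)
  have eq: "partition_fn W E (nu(v := x)) om = A + B * exp x" for x
  proof -
    have "partition_fn W E (nu(v := x)) om
        = (\<Sum>m\<in>matchings E - matchings E'. exp (hamiltonian W (nu(v := x)) om m)) + partition_fn W E' (nu(v := x)) om"
      unfolding partition_fn_def using E
      by (intro sum.subset_diff matchings_mono finite_matchings) (auto simp: E'_def)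
    also have "(\<Sum>m\<in>matchings E - matchings E'. exp (hamiltonian W (nu(v := x)) om m)) = A"
      unfolding A_def
    proof (rule sum.cong[OF refl])
      fix m assume "m \<in> matchings E - matchings E'"
      then have "v \<in> \<Union>m" by (auto simp: matchings_def E'_def)
      then show "exp (hamiltonian W (nu(v := x)) om m) = exp (hamiltonian W nu om m)"
        unfolding hamiltonian_def by (intro arg_cong[of _ _ exp] arg_cong2[of _ _ _ _ "(+)"] sum.cong) auto
    qed
    also have "partition_fn W E' (nu(v := x)) om = exp x * partition_fn (W - {v}) E' (nu(v := x)) om"
      using partition_fn_isolated[of W "{v}" E' "nu(v := x)" om] W v by (simp add: E'_def)
    also have "partition_fn (W - {v}) E' (nu(v := x)) om = B"
      unfolding B_def by (rule partition_fn_cong) auto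
    finally show ?thesis by (simp only: mult.commute)
  qed
  show thesis
  proof (rule that)
    show "0 \<le> A" unfolding A_def by (intro sum_nonneg) simp
    show B: "0 < B" unfolding B_def by (rule partition_fn_pos[OF fin])
    show "ln_Z W E (w(k := x)) = ln (A + B * exp x)" for x
    proof -
      have "(\<lambda>v. (w(k := x)) (Inl v)) = nu(v := x)" "(\<lambda>e. (w(k := x)) (Inr e)) = om"
        by (auto simp: nu_def om_def Inl)
      then show ?thesis by (simp add: ln_Z_def eq)
    qed
    \<comment> \<open>At weight 0 for \<open>v\<close>, the sum \<open>A + B\<close> is itself a
      partition function, and \<open>partition_fn_le\<close> applies.\<close>
    have "A \<le> A + B * exp 0" using B by simp
    also have "\<dots> \<le> partition_fn W E' (nu(v := 0)) om * exp (\<Sum>e\<in>E - E'. edge_bound (nu(v := 0)) om e)"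
      unfolding eq[symmetric] using W E by (intro partition_fn_le) (auto simp: E'_def)
    also have "partition_fn W E' (nu(v := 0)) om = B"
      using partition_fn_isolated[of W "{v}" E' "nu(v := 0)" om] W v
        partition_fn_cong[of "W - {v}" "nu(v := 0)" nu E' om om]
      by (simp add: E'_def B_def)
    \<comment> \<open>Putting 0 at \<open>v\<close> can only lower the absolute values in
      \<open>edge_bound\<close>.\<close>
    also have "B * exp (\<Sum>e\<in>E - E'. edge_bound (nu(v := 0)) om e) \<le> B * exp (\<Sum>e\<in>E - E'. weight_bound w e)"
      using B unfolding weight_bound_def edge_bound_def nu_def om_def
      by (simp add: sum_mono)
    also have "E - E' = {e. e \<in> E \<and> e \<inter> endpoints k \<noteq> {}}" by (auto simp: E'_def Inl)
    finally show "A \<le> B * exp (\<Sum>e | e \<in> E \<and> e \<inter> endpoints k \<noteq> {}. weight_bound w e)" .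
  qed
next
  case (Inr e)
  then have e: "e \<in> E" "e \<subseteq> W" "e \<noteq> {}" using k E by auto
  define F where "F = E - {e}"
  define F' where "F' = {e' \<in> F. e' \<inter> e = {}}"
  have F: "E = insert e F" "e \<notin> F" "finite F" "finite F'" "F' \<subseteq> F" using e E by (auto simp: F_def F'_def)
  define nu om where "nu = (\<lambda>v. w (Inl v))" and "om = (\<lambda>e. w (Inr e))"
  define A where "A = partition_fn W F nu om"
  define B where "B = partition_fn (W - e) F' nu om"
  have eq: "partition_fn W E nu (om(e := x)) = A + B * exp x" for x
  proof -
    have "partition_fn W F nu (om(e := x)) = A" "partition_fn (W - e) F' nu (om(e := x)) = B"
      unfolding A_def B_def using F by (auto intro!: partition_fn_cong)
    then show ?thesis unfolding F(1) using F e by (simp add: partition_fn_insert F'_def)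
  qed
  show thesis
  proof (rule that)
    show "0 \<le> A" unfolding A_def using partition_fn_pos[OF F(3)] by (simp add: less_imp_le)
    show B: "0 < B" unfolding B_def by (rule partition_fn_pos[OF F(4)])
    show "ln_Z W E (w(k := x)) = ln (A + B * exp x)" for x
    proof -
      have "(\<lambda>v. (w(k := x)) (Inl v)) = nu" "(\<lambda>e. (w(k := x)) (Inr e)) = om(e := x)"
        by (auto simp: nu_def om_def Inr)
      then show ?thesis by (simp add: ln_Z_def eq)
    qed
    have "A \<le> partition_fn W F' nu om * exp (\<Sum>e\<in>F - F'. weight_bound w e)"
      unfolding A_def weight_bound_def nu_def[symmetric] om_def[symmetric]
      using W F E by (intro partition_fn_le) auto
    also have "partition_fn W F' nu om = exp (\<Sum>v\<in>e. nu v) * B"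
      unfolding B_def using W e by (intro partition_fn_isolated) (auto simp: F'_def)
    \<comment> \<open>\<open>e\<close> does not lie in \<open>F - F'\<close>; its own bound absorbs
      this factor and completes the sum over incident edges.\<close>
    also have "exp (\<Sum>v\<in>e. nu v) \<le> exp (weight_bound w e)"
    proof -
      have "(\<Sum>v\<in>e. nu v) \<le> (\<Sum>v\<in>e. \<bar>nu v\<bar>)" by (intro sum_mono) simp
      moreover have "0 \<le> ln 2 + \<bar>om e\<bar>" by simp
      ultimately have "(\<Sum>v\<in>e. nu v) \<le> weight_bound w e"
        unfolding weight_bound_def edge_bound_def nu_def om_def by linarith
      then show ?thesis by simp
    qed
    finally have "A \<le> exp (weight_bound w e) * B * exp (\<Sum>e\<in>F - F'. weight_bound w e)"
      using B by (simp add: mult_right_mono)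
    also have "\<dots> = B * exp (\<Sum>e\<in>insert e (F - F'). weight_bound w e)"
      using F by (simp add: exp_add)
    also have "insert e (F - F') = {e'. e' \<in> E \<and> e' \<inter> endpoints k \<noteq> {}}"
      using e by (auto simp: F F'_def Inr)
    finally show "A \<le> B * exp (\<Sum>e | e \<in> E \<and> e \<inter> endpoints k \<noteq> {}. weight_bound w e)" .
  qed
qed

section \<open>The infinite cylinder\<close>

text \<open>Half-open ranges let the pieces from \<open>a\<close> to \<open>b\<close> and from
  \<open>b\<close> to \<open>c\<close> tile the piece from \<open>a\<close> to
  \<open>c\<close>.\<close>

definition column_verts :: "'h set \<Rightarrow> nat \<Rightarrow> nat \<Rightarrow> (nat \<times> 'h) set" where
  "column_verts VH a b = {a + 1..b} \<times> VH"

text \<open>Taking all columns at once makes every finite piece an induced subgraph, and column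
  shifts map edges to edges.\<close>

definition cylinder :: "'h set \<Rightarrow> 'h set set \<Rightarrow> (nat \<times> 'h) set set" where
  "cylinder VH EH = {{(i, j), (i + 1, j)} | i j. j \<in> VH} \<union> {{(i, j), (i, j')} | i j j'. {j, j'} \<in> EH}"

definition column_edges :: "'h set \<Rightarrow> 'h set set \<Rightarrow> nat \<Rightarrow> nat \<Rightarrow> (nat \<times> 'h) set set" where
  "column_edges VH EH a b = {e \<in> cylinder VH EH. e \<subseteq> column_verts VH a b}"

definition shift :: "nat \<Rightarrow> nat \<times> 'h \<Rightarrow> nat \<times> 'h" where
  "shift a = (\<lambda>(i, j). (i + a, j))"

lemma cyl_verts_eq_column_verts: "cyl_verts n VH = column_verts VH 0 n"
  by (simp add: cyl_verts_def path_verts_def column_verts_def)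

lemma card_cylinder:
  assumes "simple_graph VH EH" "e \<in> cylinder VH EH"
  shows "card e = 2"
  using assms by (auto simp: cylinder_def simple_graph_def card_insert_if split: if_splits)

lemma cyl_edges_eq_column_edges:
  assumes "simple_graph VH EH"
  shows "cyl_edges n VH EH = column_edges VH EH 0 n"
proof
  show "cyl_edges n VH EH \<subseteq> column_edges VH EH 0 n"
  proof
    fix e assume "e \<in> cyl_edges n VH EH"
    then obtain i j i' j' where e: "e = {(i, j), (i', j')}" and
      "({i, i'} \<in> path_edges n \<and> j = j' \<and> j \<in> VH) \<or> (i = i' \<and> i \<in> path_verts n \<and> {j, j'} \<in> EH)"
      by (auto simp: cyl_edges_def cart_edges_def)
    then consider k where "{i, i'} = {k, k + 1}" "1 \<le> k" "k + 1 \<le> n" "j = j'" "j \<in> VH"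
      | "i = i'" "i \<in> path_verts n" "{j, j'} \<in> EH"
      by (auto simp: path_edges_def)
    then show "e \<in> column_edges VH EH 0 n"
    proof cases
      case 1
      then have "e = {(k, j), (k + 1, j)}" using e by (auto simp: doubleton_eq_iff)
      then show ?thesis using 1 by (auto simp: column_edges_def cylinder_def column_verts_def)
    next
      case 2
      then have "j \<in> VH" "j' \<in> VH" using assms by (auto simp: simple_graph_def)
      then show ?thesis using 2 e by (auto simp: column_edges_def cylinder_def column_verts_def path_verts_def)
    qed
  qed
  show "column_edges VH EH 0 n \<subseteq> cyl_edges n VH EH"
  proof
    fix e assume "e \<in> column_edges VH EH 0 n"
    then have sub: "e \<subseteq> column_verts VH 0 n" and "e \<in> cylinder VH EH" by (auto simp: column_edges_def)
    then consider i j where "e = {(i, j), (i + 1, j)}" "j \<in> VH"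
      | i j j' where "e = {(i, j), (i, j')}" "{j, j'} \<in> EH"
      unfolding cylinder_def by blast
    then show "e \<in> cyl_edges n VH EH"
    proof cases
      case 1
      then have "{i, i + 1} \<in> path_edges n" using sub by (auto simp: path_edges_def column_verts_def)
      then show ?thesis using 1 unfolding cyl_edges_def cart_edges_def by blast
    next
      case 2
      then have "i \<in> path_verts n" using sub by (auto simp: path_verts_def column_verts_def)
      then show ?thesis using 2 unfolding cyl_edges_def cart_edges_def by blast
    qed
  qed
qed

lemma finite_column_verts: "finite VH \<Longrightarrow> finite (column_verts VH a b)"
  by (simp add: column_verts_def)

lemma finite_column_edges: "finite VH \<Longrightarrow> finite (column_edges VH EH a b)"
  by (rule finite_subset[of _ "Pow (column_verts VH a b)"]) (auto simp: column_edges_def finite_column_verts)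

lemma column_edges_sub:
  assumes "simple_graph VH EH" "e \<in> column_edges VH EH a b"
  shows "e \<subseteq> column_verts VH a b \<and> e \<noteq> {}"
  using card_cylinder[OF assms(1), of e] assms(2) by (auto simp: column_edges_def)

lemma column_verts_Un: "a \<le> b \<Longrightarrow> b \<le> c \<Longrightarrow> column_verts VH a c = column_verts VH a b \<union> column_verts VH b c"
  by (auto simp: column_verts_def)

lemma column_verts_Int: "column_verts VH a b \<inter> column_verts VH b c = {}"
  by (auto simp: column_verts_def)

lemma column_verts_mono: "a \<le> a' \<Longrightarrow> b' \<le> b \<Longrightarrow> column_verts VH a' b' \<subseteq> column_verts VH a b"
  by (auto simp: column_verts_def)

lemma column_edges_mono: "a \<le> a' \<Longrightarrow> b' \<le> b \<Longrightarrow> column_edges VH EH a' b' \<subseteq> column_edges VH EH a b"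
  using column_verts_mono[of a a' b' b VH] by (auto simp: column_edges_def)

text \<open>The number of edges lost at a cut does not depend on \<open>a\<close> or
  \<open>c\<close>; hence one constant bounds all defects.\<close>

lemma column_edges_crossing:
  assumes "a \<le> b" "b \<le> c"
  shows "column_edges VH EH a c - (column_edges VH EH a b \<union> column_edges VH EH b c)
    \<subseteq> (\<lambda>j. {(b, j), (b + 1, j)}) ` VH"
proof
  fix e assume *: "e \<in> column_edges VH EH a c - (column_edges VH EH a b \<union> column_edges VH EH b c)"
  then have sub: "e \<subseteq> column_verts VH a c" "\<not> e \<subseteq> column_verts VH a b" "\<not> e \<subseteq> column_verts VH b c" and "e \<in> cylinder VH EH"
    by (auto simp: column_edges_def)
  then consider i j where "e = {(i, j), (i + 1, j)}" "j \<in> VH"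
    | i j j' where "e = {(i, j), (i, j')}" "{j, j'} \<in> EH"
    unfolding cylinder_def by blast
  then show "e \<in> (\<lambda>j. {(b, j), (b + 1, j)}) ` VH"
  proof cases
    case 1
    then have "i = b" using sub by (auto simp: column_verts_def)
    then show ?thesis using 1 by blast
  next
    case 2
    then show ?thesis using sub by (auto simp: column_verts_def)
  qed
qed

section \<open>Translation along the cylinder\<close>

lemma inj_shift: "inj (shift a)"
  by (auto simp: shift_def inj_on_def)

lemma shift_column_verts: "shift a ` column_verts VH 0 m = column_verts VH a (a + m)"
proof
  show "column_verts VH a (a + m) \<subseteq> shift a ` column_verts VH 0 m"
  proof
    fix v assume "v \<in> column_verts VH a (a + m)"
    then have "v = shift a (fst v - a, snd v)" "(fst v - a, snd v) \<in> column_verts VH 0 m"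
      by (auto simp: shift_def column_verts_def)
    then show "v \<in> shift a ` column_verts VH 0 m" by blast
  qed
qed (auto simp: shift_def column_verts_def)

lemma shift_cylinder:
  assumes "e \<in> cylinder VH EH" shows "shift a ` e \<in> cylinder VH EH"
proof -
  consider i j where "e = {(i, j), (i + 1, j)}" "j \<in> VH"
    | i j j' where "e = {(i, j), (i, j')}" "{j, j'} \<in> EH"
    using assms unfolding cylinder_def by blast
  then show ?thesis
  proof cases
    case 1
    then have "shift a ` e = {(i + a, j), (i + a + 1, j)}" by (simp add: shift_def)
    then show ?thesis using 1 unfolding cylinder_def by blast
  next
    case 2
    then have "shift a ` e = {(i + a, j), (i + a, j')}" by (simp add: shift_def)
    then show ?thesis using 2 unfolding cylinder_def by blast
  qed
qed

text \<open>Lying in the range of the shift forces \<open>a \<le> i\<close>, so the subtraction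
  \<open>i - a\<close> is exact.\<close>

lemma unshift_cylinder:
  assumes "e \<in> cylinder VH EH" "e \<subseteq> range (shift a)"
  obtains e' where "e' \<in> cylinder VH EH" "e = shift a ` e'"
proof -
  consider i j where "e = {(i, j), (i + 1, j)}" "j \<in> VH"
    | i j j' where "e = {(i, j), (i, j')}" "{j, j'} \<in> EH"
    using assms unfolding cylinder_def by blast
  then show ?thesis
  proof cases
    case 1
    then have "a \<le> i" using assms(2) by (auto simp: shift_def)
    then have "e = shift a ` {(i - a, j), (i - a + 1, j)}" using 1 by (simp add: shift_def)
    moreover have "{(i - a, j), (i - a + 1, j)} \<in> cylinder VH EH" using 1 unfolding cylinder_def by blast
    ultimately show ?thesis using that by blast
  next
    case 2
    then have "a \<le> i" using assms(2) by (auto simp: shift_def)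
    then have "e = shift a ` {(i - a, j), (i - a, j')}" using 2 by (simp add: shift_def)
    moreover have "{(i - a, j), (i - a, j')} \<in> cylinder VH EH" using 2 unfolding cylinder_def by blast
    ultimately show ?thesis using that by blast
  qed
qed

lemma shift_column_edges: "(`) (shift a) ` column_edges VH EH 0 m = column_edges VH EH a (a + m)"
proof
  show "(`) (shift a) ` column_edges VH EH 0 m \<subseteq> column_edges VH EH a (a + m)"
    unfolding column_edges_def shift_column_verts[symmetric] using shift_cylinder by blast
  show "column_edges VH EH a (a + m) \<subseteq> (`) (shift a) ` column_edges VH EH 0 m"
  proof
    fix e assume "e \<in> column_edges VH EH a (a + m)"
    then have e: "e \<in> cylinder VH EH" "e \<subseteq> shift a ` column_verts VH 0 m"
      by (auto simp: column_edges_def shift_column_verts)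
    then obtain e' where e': "e' \<in> cylinder VH EH" "e = shift a ` e'"
      using unshift_cylinder by (metis image_mono subset_UNIV subset_trans)
    then have "e' \<subseteq> column_verts VH 0 m" using e(2) by (simp add: inj_image_subset_iff[OF inj_shift])
    then show "e \<in> (`) (shift a) ` column_edges VH EH 0 m"
      using e' by (auto simp: column_edges_def)
  qed
qed

text \<open>An edge that meets column \<open>i\<close> or \<open>i + 1\<close> stays within four
  columns. Counting all vertex sets there is crude, but independent of \<open>a\<close> and
  \<open>b\<close>.\<close>

lemma card_incident_edges:
  assumes "finite VH" "t \<subseteq> {i, i + 1} \<times> UNIV"
  shows "card {e \<in> column_edges VH EH a b. e \<inter> t \<noteq> {}} \<le> 2 ^ (4 * card VH)"
proof -
  have "e \<subseteq> {i - 1..i + 2} \<times> VH" if e: "e \<in> column_edges VH EH a b" "e \<inter> t \<noteq> {}" for e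
  proof -
    have VH: "e \<subseteq> UNIV \<times> VH" using e by (auto simp: column_edges_def column_verts_def)
    have "e \<in> cylinder VH EH" using e by (auto simp: column_edges_def)
    then consider k j where "e = {(k, j), (k + 1, j)}" | k j j' where "e = {(k, j), (k, j')}"
      unfolding cylinder_def by blast
    then show ?thesis
    proof cases
      case 1
      then have "k = i \<or> k = i + 1 \<or> k + 1 = i \<or> k + 1 = i + 1" using e(2) assms(2) by auto
      then show ?thesis using 1 VH by auto
    next
      case 2
      then have "k = i \<or> k = i + 1" using e(2) assms(2) by auto
      then show ?thesis using 2 VH by auto
    qed
  qed
  then have "{e \<in> column_edges VH EH a b. e \<inter> t \<noteq> {}} \<subseteq> Pow ({i - 1..i + 2} \<times> VH)" by blast
  then have "card {e \<in> column_edges VH EH a b. e \<inter> t \<noteq> {}} \<le> card (Pow ({i - 1..i + 2} \<times> VH))"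
    using assms(1) by (intro card_mono) auto
  also have "\<dots> = 2 ^ (card {i - 1..i + 2} * card VH)" using assms(1) by (simp add: card_Pow card_cartesian_product)
  \<comment> \<open>For \<open>i = 0\<close> the subtraction \<open>i - 1\<close> is truncated and
    only three columns remain.\<close>
  also have "\<dots> \<le> 2 ^ (4 * card VH)" by (intro power_increasing mult_right_mono) auto
  finally show ?thesis .
qed

section \<open>Products of infinitely many laws\<close>

text \<open>Stands in for measurability with respect to the coordinates in \<open>A\<close>.\<close>

definition depends_on :: "'k set \<Rightarrow> (('k \<Rightarrow> real) \<Rightarrow> real) \<Rightarrow> bool" where
  "depends_on A g \<longleftrightarrow> (\<forall>w w'. (\<forall>k\<in>A. w k = w' k) \<longrightarrow> g w = g w')"

lemma depends_onD: "depends_on A g \<Longrightarrow> (\<And>k. k \<in> A \<Longrightarrow> w k = w' k) \<Longrightarrow> g w = g w'"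
  by (auto simp: depends_on_def)

lemma depends_on_mono: "depends_on A g \<Longrightarrow> A \<subseteq> B \<Longrightarrow> depends_on B g"
  by (auto simp: depends_on_def)

locale product_of_laws =
  fixes N :: "'k \<Rightarrow> real measure"
  assumes laws: "\<And>k. real_distribution (N k)"
begin

abbreviation P :: "('k \<Rightarrow> real) measure" where "P \<equiv> PiM UNIV N"

lemma prob_N: "prob_space (N k)"
  using laws by (simp add: real_distribution_def)

lemma sets_N [measurable_cong]: "sets (N k) = sets borel"
  using laws by (simp add: real_distribution_def real_distribution_axioms_def)

lemma space_N: "space (N k) = UNIV"
  using sets_eq_imp_space_eq[OF sets_N] by simp

sublocale prob_space P
  by (intro prob_space_PiM prob_N)

lemma component_measurable: "(\<lambda>w. w k) \<in> borel_measurable P"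
proof -
  have "(\<lambda>w. w k) \<in> measurable P (N k)" by (rule measurable_component_singleton) simp
  then show ?thesis by (simp cong: measurable_cong_sets add: sets_N)
qed

lemma distr_component: "distr P borel (\<lambda>w. w k) = N k"
proof -
  have "distr P borel (\<lambda>w. w k) = distr P (N k) (\<lambda>w. w k)"
    by (intro distr_cong) (auto simp: sets_N)
  then show ?thesis using distr_PiM_component[of UNIV N k] prob_N by simp
qed

lemma measurable_into_P:
  assumes "\<And>k. (\<lambda>x. f x k) \<in> borel_measurable M"
  shows "f \<in> measurable M P"
  by (rule measurable_PiM_single') (use assms in \<open>auto simp: sets_N space_N cong: measurable_cong_sets\<close>)

lemma indep_components: "indep_vars (\<lambda>_. borel) (\<lambda>k w. w k) UNIV"
proof (subst indep_vars_iff_distr_eq_PiM')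
  have "distr P (PiM UNIV (\<lambda>_. borel)) (\<lambda>w. \<lambda>k\<in>UNIV. w k) = distr P P (\<lambda>w. w)"
    by (intro distr_cong sets_PiM_cong) (auto simp: sets_N)
  also have "\<dots> = P" by (simp add: distr_id[unfolded id_def])
  finally show "distr P (PiM UNIV (\<lambda>_. borel)) (\<lambda>w. \<lambda>k\<in>UNIV. w k) = PiM UNIV (\<lambda>k. distr P borel (\<lambda>w. w k))"
    by (simp add: distr_component)
qed (auto simp: component_measurable)

lemma indep_vars_depends_on:
  assumes g: "\<And>j. j \<in> J \<Longrightarrow> g j \<in> borel_measurable P" "\<And>j. j \<in> J \<Longrightarrow> depends_on (A j) (g j)"
    and A: "disjoint_family_on A J"
  shows "indep_vars (\<lambda>_. borel) g J"
proof -
  \<comment> \<open>Filling the missing coordinates with 0 turns a point of the partial product into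
    a point of \<open>P\<close>; \<open>g j\<close> does not see the filled values.\<close>
  define Y where "Y = (\<lambda>j x. g j (\<lambda>k. if k \<in> A j then x k else 0))"
  have "indep_vars (\<lambda>j. PiM (A j) (\<lambda>_. borel)) (\<lambda>j w. restrict (\<lambda>k. w k) (A j)) J"
    by (rule indep_vars_restrict[OF indep_components _ A]) simp
  then have "indep_vars (\<lambda>_. borel) (\<lambda>j w. Y j (restrict (\<lambda>k. w k) (A j))) J"
  proof (rule indep_vars_compose2)
    fix j assume "j \<in> J"
    have "(\<lambda>x k. if k \<in> A j then x k else 0) \<in> measurable (PiM (A j) (\<lambda>_. borel)) P"
    proof (rule measurable_into_P)
      show "(\<lambda>x. if k \<in> A j then x k else 0) \<in> borel_measurable (PiM (A j) (\<lambda>_. borel))" for k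
        by (cases "k \<in> A j") simp_all
    qed
    then show "Y j \<in> borel_measurable (PiM (A j) (\<lambda>_. borel))"
      unfolding Y_def using g(1)[OF \<open>j \<in> J\<close>] by (rule measurable_compose)
  qed
  moreover have "Y j (restrict (\<lambda>k. w k) (A j)) = g j w" if "j \<in> J" for j w
    unfolding Y_def by (rule depends_onD[OF g(2)[OF that]]) simp
  ultimately show ?thesis by (simp cong: indep_vars_cong)
qed

lemma indep_var_depends_on:
  assumes "X \<in> borel_measurable P" "depends_on A X" "Y \<in> borel_measurable P" "depends_on B Y" "A \<inter> B = {}"
  shows "indep_var borel X borel Y"
proof -
  have "indep_vars (\<lambda>_. borel) (case_bool X Y) UNIV"
    by (rule indep_vars_depends_on[where A = "case_bool A B"])
       (use assms in \<open>auto simp: disjoint_family_on_def split: bool.splits\<close>)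
  moreover have "(\<lambda>_. borel) = case_bool borel borel" by (auto simp: fun_eq_iff split: bool.split)
  ultimately show ?thesis unfolding indep_var_def by metis
qed

text \<open>Distinct coordinates with unchanged laws again have a product law. Injectivity is the
  right condition: the column shift is not surjective.\<close>

lemma distr_reindex:
  assumes "inj s" "\<And>k. N (s k) = N k" "g \<in> borel_measurable P"
  shows "distr P borel (\<lambda>w. g (\<lambda>k. w (s k))) = distr P borel g"
proof -
  have m: "(\<lambda>w k. w (s k)) \<in> measurable P P"
    by (intro measurable_into_P component_measurable)
  have "distr P P (\<lambda>w k. w (s k)) = P"
    using distr_PiM_reindex[of UNIV N s UNIV] assms(1,2) prob_N by (simp add: restrict_def)
  then have "distr P borel g = distr (distr P P (\<lambda>w k. w (s k))) borel g" by simp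
  also have "\<dots> = distr P borel (\<lambda>w. g (\<lambda>k. w (s k)))"
    using distr_distr[OF assms(3) m] by (simp add: comp_def)
  finally show ?thesis by simp
qed

lemma expectation_mult_depends_on:
  assumes "X \<in> borel_measurable P" "depends_on (- {k}) X" "integrable P X"
    and \<phi> [measurable]: "\<phi> \<in> borel_measurable borel" and "integrable P (\<lambda>w. \<phi> (w k))"
  shows "expectation (\<lambda>w. X w * \<phi> (w k)) = expectation X * expectation (\<lambda>w. \<phi> (w k))"
    and "integrable P (\<lambda>w. X w * \<phi> (w k))"
proof -
  have "(\<lambda>w. \<phi> (w k)) \<in> borel_measurable P"
    using component_measurable by (rule measurable_compose) simp
  moreover have "depends_on {k} (\<lambda>w. \<phi> (w k))" by (auto simp: depends_on_def)
  ultimately have i: "indep_var borel X borel (\<lambda>w. \<phi> (w k))"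
    using assms(1,2) by (intro indep_var_depends_on[where A = "- {k}" and B = "{k}"]) auto
  show "expectation (\<lambda>w. X w * \<phi> (w k)) = expectation X * expectation (\<lambda>w. \<phi> (w k))"
    "integrable P (\<lambda>w. X w * \<phi> (w k))"
    using indep_var_lebesgue_integral[OF i] indep_var_integrable[OF i] assms by auto
qed

lemma square_integrable_indicator:
  assumes [measurable]: "S \<in> sets borel"
  shows "square_integrable P (\<lambda>w. indicat_real S (w k))"
proof -
  have [measurable]: "(\<lambda>w. w k) \<in> borel_measurable P" by (rule component_measurable)
  have "(indicat_real S (w k))\<^sup>2 = indicat_real S (w k)" for w by (auto simp: indicator_def)
  moreover have "integrable P (\<lambda>w. indicat_real S (w k))"
    by (rule integrable_const_bound[of _ 1]) (auto simp: indicator_def)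
  ultimately show ?thesis by (simp add: square_integrable_def)
qed

lemma expectation_indicator:
  assumes [measurable]: "S \<in> sets borel"
  shows "expectation (\<lambda>w. indicat_real S (w k)) = measure (N k) S"
proof -
  have [measurable]: "(\<lambda>w. w k) \<in> borel_measurable P" by (rule component_measurable)
  interpret Nk: prob_space "N k" by (rule prob_N)
  have "measure (N k) S = (\<integral>x. indicat_real S x \<partial>N k)"
    using assms by (simp add: sets_N Nk.emeasure_eq_measure)
  also have "\<dots> = expectation (\<lambda>w. indicat_real S (w k))"
    by (subst distr_component[symmetric], subst integral_distr) auto
  finally show ?thesis by simp
qed

text \<open>Conditionally on the other coordinates, \<open>F\<close> is at least \<open>F(w(k := b))\<close> where
  \<open>w k \<ge> b\<close>, at most that elsewhere, and at most \<open>F(w(k := a))\<close> where \<open>w k \<le> a\<close>.\<close>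

lemma covariance_indicator_ge:
  assumes F: "square_integrable P F"
    and Fx: "\<And>x. square_integrable P (\<lambda>w. F (w(k := x)))"
    and mono: "\<And>w x y. x \<le> y \<Longrightarrow> F (w(k := x)) \<le> F (w(k := y))"
    and ab: "a < b"
  defines "p \<equiv> measure (N k) {b..}" and "q \<equiv> measure (N k) {..a}"
  shows "p * q * (expectation (\<lambda>w. F (w(k := b))) - expectation (\<lambda>w. F (w(k := a))))
    \<le> expectation (\<lambda>w. F w * (indicator {b..} (w k) - p))"
proof -
  define Fb Fa where "Fb = (\<lambda>w. F (w(k := b)))" and "Fa = (\<lambda>w. F (w(k := a)))"
  define U V where "U = (\<lambda>w::'k \<Rightarrow> real. indicat_real {b..} (w k))" and "V = (\<lambda>w::'k \<Rightarrow> real. indicat_real {..a} (w k))"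
  note ind = square_integrable_indicator
  have U: "square_integrable P U" and V: "square_integrable P V" unfolding U_def V_def by (auto intro!: ind)
  have Ep: "expectation U = p" and Eq: "expectation V = q"
    unfolding U_def V_def p_def q_def by (auto intro!: expectation_indicator)
  have dep: "depends_on (- {k}) Fb" "depends_on (- {k}) Fa"
    unfolding depends_on_def Fb_def Fa_def by (auto intro!: arg_cong[of _ _ F])
  have sq: "square_integrable P Fb" "square_integrable P Fa"
    unfolding Fb_def Fa_def by (rule Fx)+
  note int = square_integrableD(3)[OF sq(1)] square_integrableD(3)[OF sq(2)]
  have FbU: "expectation (\<lambda>w. Fb w * U w) = expectation Fb * p"
    unfolding Ep[symmetric] U_def
    using expectation_mult_depends_on(1)[of Fb k "indicat_real {b..}"] dep int
      square_integrableD(1)[OF sq(1)] square_integrableD(3)[OF ind[of "{b..}"]] by simp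
  have FbV: "expectation (\<lambda>w. Fb w * V w) = expectation Fb * q"
    unfolding Eq[symmetric] V_def
    using expectation_mult_depends_on(1)[of Fb k "indicat_real {..a}"] dep int
      square_integrableD(1)[OF sq(1)] square_integrableD(3)[OF ind[of "{..a}"]] by simp
  have FaV: "expectation (\<lambda>w. Fa w * V w) = expectation Fa * q"
    unfolding Eq[symmetric] V_def
    using expectation_mult_depends_on(1)[of Fa k "indicat_real {..a}"] dep int
      square_integrableD(1)[OF sq(2)] square_integrableD(3)[OF ind[of "{..a}"]] by simp
  have p01: "0 \<le> p" "p \<le> 1"
    using prob_space.prob_le_1[OF prob_N] by (auto simp: p_def)
  \<comment> \<open>\<open>?R\<close> is the pointwise lower bound in the three ranges of
    \<open>w k\<close>. By independence its first bracket has mean zero and the rest has mean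
    \<open>p * q * (expectation Fb - expectation Fa)\<close>.\<close>
  let ?R = "\<lambda>w. (Fb w * U w - p * Fb w) + p * (Fb w * V w - Fa w * V w)"
  have intR: "integrable P (\<lambda>w. Fb w * U w)" "integrable P (\<lambda>w. Fb w * V w)" "integrable P (\<lambda>w. Fa w * V w)"
    using square_integrable_mult[OF sq(1) U] square_integrable_mult[OF sq(1) V]
      square_integrable_mult[OF sq(2) V] by auto
  have "p * q * (expectation Fb - expectation Fa) = expectation ?R"
    using intR int by (simp add: FbU FbV FaV algebra_simps)
  also have "\<dots> \<le> expectation (\<lambda>w. F w * (U w - p))"
  proof (rule integral_mono)
    show "integrable P ?R" using intR int by simp
    show "integrable P (\<lambda>w. F w * (U w - p))"
      by (rule square_integrable_mult[OF F square_integrable_diff[OF U square_integrable_const]])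
    fix w
    have self: "F w = F (w(k := w k))" by simp
    consider "b \<le> w k" | "w k < b" "a < w k" | "w k \<le> a" by linarith
    then show "?R w \<le> F w * (U w - p)"
    proof cases
      case 1
      then have UV: "U w = 1" "V w = 0" using ab by (auto simp: U_def V_def)
      have "Fb w \<le> F w" unfolding Fb_def by (subst self) (use 1 in \<open>rule mono\<close>)
      then have "Fb w * (1 - p) \<le> F w * (1 - p)" using p01 by (intro mult_right_mono) auto
      then show ?thesis by (simp add: UV algebra_simps)
    next
      case 2
      then have UV: "U w = 0" "V w = 0" by (auto simp: U_def V_def)
      have "F w \<le> Fb w" unfolding Fb_def by (subst self) (use 2 in \<open>intro mono, simp\<close>)
      then have "F w * p \<le> Fb w * p" using p01 by (intro mult_right_mono) auto
      then show ?thesis by (simp add: UV algebra_simps)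
    next
      case 3
      then have UV: "U w = 0" "V w = 1" using ab by (auto simp: U_def V_def)
      have "F w \<le> Fa w" unfolding Fa_def by (subst self) (use 3 in \<open>intro mono, simp\<close>)
      then have "F w * p \<le> Fa w * p" using p01 by (intro mult_right_mono) auto
      then show ?thesis by (simp add: UV algebra_simps)
    qed
  qed
  finally show ?thesis by (simp add: Fb_def Fa_def U_def)
qed

end

text \<open>If almost no mass lay on one side of the mean \<open>m\<close>, the mean would force
  \<open>x = m\<close> almost surely. The witnesses are \<open>b = m\<close> and a point
  \<open>a\<close> strictly below it.\<close>

lemma nondegenerate_law:
  assumes "real_distribution mu" "\<not> degenerate_law mu"
    and int: "integrable mu (\<lambda>x. x)"
  obtains a b where "a < b" "0 < measure mu {b..}" "0 < measure mu {..a}"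
proof -
  interpret real_distribution mu by fact
  define m where "m = expectation (\<lambda>x. x)"
  have UNIV_1: "prob UNIV = 1" using prob_space by simp
  have nAE: "\<not> (AE x in mu. x = m)"
  proof
    assume ae: "AE x in mu. x = m"
    have "mu = return borel m"
    proof (rule measure_eqI)
      fix A assume "A \<in> sets mu"
      then have A [measurable]: "A \<in> sets borel" by simp
      have "emeasure mu A = (\<integral>\<^sup>+x. indicator A x \<partial>mu)" by simp
      also have "\<dots> = (\<integral>\<^sup>+x. indicator A m \<partial>mu)"
        by (rule nn_integral_cong_AE) (use ae in auto)
      also have "\<dots> = emeasure (return borel m) A" by (simp add: emeasure_space_1[simplified])
      finally show "emeasure mu A = emeasure (return borel m) A" .
    qed simp
    then show False using assms(2) by (auto simp: degenerate_law_def)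
  qed
  have upper: "0 < measure mu {m..}"
  proof (rule ccontr)
    assume "\<not> ?thesis"
    then have "measure mu {m..} = 0" using measure_nonneg[of mu "{m..}"] by linarith
    then have "AE x in mu. x \<notin> {m..}" by (intro AE_I'[of "{m..}"]) (auto simp: null_sets_def emeasure_eq_measure)
    then have lt: "AE x in mu. x < m" by eventually_elim auto
    then have "AE x in mu. 0 \<le> m - x" by eventually_elim auto
    moreover have "expectation (\<lambda>x. m - x) = 0" using int UNIV_1 by (simp add: m_def)
    ultimately have "AE x in mu. m - x = 0"
      using int by (subst (asm) integral_nonneg_eq_0_iff_AE) auto
    then have "AE x in mu. x = m" by eventually_elim simp
    then show False using nAE by simp
  qed
  \<comment> \<open>A gap below \<open>m\<close> is needed for \<open>a < b\<close>. If all these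
    countably many sets were null, \<open>m \<le> x\<close> would hold almost surely.\<close>
  have "\<exists>j. measure mu {..m - 1 / Suc j} \<noteq> 0"
  proof (rule ccontr)
    assume "\<nexists>j. measure mu {..m - 1 / Suc j} \<noteq> 0"
    then have "AE x in mu. x \<notin> {..m - 1 / Suc j}" for j
      by (intro AE_I'[of "{..m - 1 / Suc j}"]) (auto simp: null_sets_def emeasure_eq_measure)
    then have "AE x in mu. \<forall>j. m - 1 / Suc j < x" by (simp add: AE_all_countable not_le)
    then have ge: "AE x in mu. 0 \<le> x - m"
    proof eventually_elim
      case (elim x)
      have "(\<lambda>j. m - 1 / real (Suc j)) \<longlonglongrightarrow> m - 0"
        by (intro tendsto_diff tendsto_const LIMSEQ_Suc lim_1_over_n)
      then have "m - 0 \<le> x" by (rule LIMSEQ_le_const2) (use elim in \<open>auto intro: less_imp_le\<close>)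
      then show ?case by simp
    qed
    moreover have "expectation (\<lambda>x. x - m) = 0" using int UNIV_1 by (simp add: m_def)
    ultimately have "AE x in mu. x - m = 0"
      using int by (subst (asm) integral_nonneg_eq_0_iff_AE) auto
    then have "AE x in mu. x = m" by eventually_elim simp
    then show False using nAE by simp
  qed
  then obtain j where "measure mu {..m - 1 / Suc j} \<noteq> 0" by blast
  then have "0 < measure mu {..m - 1 / Suc j}" using measure_nonneg[of mu "{..m - 1 / Suc j}"] by linarith
  then show thesis by (intro that[of "m - 1 / Suc j" m]) (use upper in auto)
qed

section \<open>The free energy of a random cylinder\<close>

lemma (in prob_space) square_integrable_bound:
  assumes "X \<in> borel_measurable M" "square_integrable M Y" "\<And>x. \<bar>X x\<bar> \<le> Y x"
  shows "square_integrable M X"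
  unfolding square_integrable_def
proof
  show "integrable M (\<lambda>x. (X x)\<^sup>2)"
  proof (rule Bochner_Integration.integrable_bound)
    show "integrable M (\<lambda>x. (Y x)\<^sup>2)" using assms(2) by (rule square_integrableD)
    show "AE x in M. norm ((X x)\<^sup>2) \<le> norm ((Y x)\<^sup>2)"
    proof (rule AE_I2)
      fix x
      have "\<bar>X x\<bar>\<^sup>2 \<le> (Y x)\<^sup>2" using assms(3) by (intro power_mono) auto
      then show "norm ((X x)\<^sup>2) \<le> norm ((Y x)\<^sup>2)" by simp
    qed
  qed (use assms(1) in measurable)
qed (rule assms(1))

lemma (in prob_space) square_integrable_abs:
  "square_integrable M X \<Longrightarrow> square_integrable M (\<lambda>x. \<bar>X x\<bar>)"
  by (auto simp: square_integrable_def)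

lemma measurable_ln_Z:
  assumes "\<And>k. k \<in> W <+> E \<Longrightarrow> X k \<in> borel_measurable M"
  shows "(\<lambda>x. ln_Z W E (\<lambda>k. X k x)) \<in> borel_measurable M"
proof -
  have "(\<lambda>x. hamiltonian W (\<lambda>v. X (Inl v) x) (\<lambda>e. X (Inr e) x) m) \<in> borel_measurable M"
    if "m \<in> matchings E" for m
    unfolding hamiltonian_def
    by (intro borel_measurable_add borel_measurable_sum assms) (use that in \<open>auto simp: matchings_def\<close>)
  then have "(\<lambda>x. partition_fn W E (\<lambda>v. X (Inl v) x) (\<lambda>e. X (Inr e) x)) \<in> borel_measurable M"
    unfolding partition_fn_def by (intro borel_measurable_sum measurable_compose[OF _ borel_measurable_exp])
  then show ?thesis unfolding ln_Z_def by (rule borel_measurable_ln)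
qed

text \<open>Comparison with the edgeless graph, whose free energy is the sum of the vertex
  weights.\<close>

lemma abs_ln_Z_le:
  assumes "finite W" "finite E" "\<And>e. e \<in> E \<Longrightarrow> e \<subseteq> W \<and> e \<noteq> {}"
  shows "\<bar>ln_Z W E w\<bar> \<le> (\<Sum>v\<in>W. \<bar>w (Inl v)\<bar>) + (\<Sum>e\<in>E. weight_bound w e)"
proof -
  let ?nu = "\<lambda>v. w (Inl v)" and ?om = "\<lambda>e. w (Inr e)"
  have "\<bar>\<Sum>v\<in>W. w (Inl v)\<bar> \<le> (\<Sum>v\<in>W. \<bar>w (Inl v)\<bar>)" by (rule sum_abs)
  moreover have "0 \<le> ln (partition_fn W E ?nu ?om) - ln (partition_fn W {} ?nu ?om)"
    using assms by (intro ln_partition_fn_diff) auto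
  moreover have "ln (partition_fn W E ?nu ?om) - ln (partition_fn W {} ?nu ?om) \<le> (\<Sum>e\<in>E - {}. edge_bound ?nu ?om e)"
    using assms by (intro ln_partition_fn_diff) auto
  ultimately show ?thesis
    unfolding partition_fn_no_edges ln_exp Diff_empty ln_Z_def weight_bound_def by linarith
qed

lemma (in prob_space) square_integrable_weight_bound:
  assumes "\<And>k. square_integrable M (X k)"
  shows "square_integrable M (\<lambda>x. weight_bound (\<lambda>k. X k x) e)"
  unfolding weight_bound_def edge_bound_def
  by (intro square_integrable_add square_integrable_sum square_integrable_const square_integrable_abs assms)

lemma (in prob_space) square_integrable_ln_Z:
  assumes X: "\<And>k. square_integrable M (X k)"
    and "finite W" "finite E" "\<And>e. e \<in> E \<Longrightarrow> e \<subseteq> W \<and> e \<noteq> {}"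
  shows "square_integrable M (\<lambda>x. ln_Z W E (\<lambda>k. X k x))"
proof (rule square_integrable_bound)
  show "(\<lambda>x. ln_Z W E (\<lambda>k. X k x)) \<in> borel_measurable M"
    using X by (intro measurable_ln_Z square_integrableD(1))
  show "square_integrable M (\<lambda>x. (\<Sum>v\<in>W. \<bar>X (Inl v) x\<bar>) + (\<Sum>e\<in>E. weight_bound (\<lambda>k. X k x) e))"
    using X by (intro square_integrable_add square_integrable_sum square_integrable_abs square_integrable_weight_bound)
qed (rule abs_ln_Z_le[OF assms(2-4)])

lemma depends_on_ln_Z: "depends_on (W <+> E) (ln_Z W E)"
  unfolding depends_on_def ln_Z_def
  by (intro allI impI arg_cong[of _ _ ln] partition_fn_cong) auto

text \<open>The factor 4 is Cauchy-Schwarz for four summands: \<open>ln 2\<close>, one edge weight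
  and two vertex weights.\<close>

lemma weight_bound_squared_le:
  assumes "card e = 2"
  shows "(weight_bound w e)\<^sup>2 \<le> 4 * (1 + (w (Inr e))\<^sup>2 + (\<Sum>v\<in>e. (w (Inl v))\<^sup>2))"
proof -
  obtain u v where e: "e = {u, v}" "u \<noteq> v" using assms by (auto simp: card_2_iff)
  have four: "(a + b + c + d)\<^sup>2 \<le> 4 * (a\<^sup>2 + b\<^sup>2 + c\<^sup>2 + d\<^sup>2)" for a b c d :: real
  proof -
    have "4 * (a\<^sup>2 + b\<^sup>2 + c\<^sup>2 + d\<^sup>2) - (a + b + c + d)\<^sup>2
        = (a - b)\<^sup>2 + (a - c)\<^sup>2 + (a - d)\<^sup>2 + (b - c)\<^sup>2 + (b - d)\<^sup>2 + (c - d)\<^sup>2"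
      by (simp add: power2_eq_square algebra_simps)
    also have "\<dots> \<ge> 0" by simp
    finally show ?thesis by simp
  qed
  have ln2: "(ln 2)\<^sup>2 \<le> (1::real)"
    using ln_le_minus_one[of 2] by (simp add: abs_le_square_iff[of "ln 2" 1, simplified, symmetric])
  have "(weight_bound w e)\<^sup>2 = (ln 2 + \<bar>w (Inr e)\<bar> + \<bar>w (Inl u)\<bar> + \<bar>w (Inl v)\<bar>)\<^sup>2"
    using e by (simp add: weight_bound_def edge_bound_def add.assoc)
  also have "\<dots> \<le> 4 * ((ln 2)\<^sup>2 + (w (Inr e))\<^sup>2 + (w (Inl u))\<^sup>2 + (w (Inl v))\<^sup>2)"
    using four[of "ln 2" "\<bar>w (Inr e)\<bar>" "\<bar>w (Inl u)\<bar>" "\<bar>w (Inl v)\<bar>"] by simp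
  also have "\<dots> \<le> 4 * (1 + (w (Inr e))\<^sup>2 + (\<Sum>v\<in>e. (w (Inl v))\<^sup>2))"
    using ln2 e by simp
  finally show ?thesis .
qed

locale random_cylinder =
  fixes VH :: "'h set" and EH :: "'h set set" and mu eta :: "real measure"
  assumes fin: "finite VH" and nonempty: "VH \<noteq> {}" and simple: "simple_graph VH EH"
    and mu: "real_distribution mu" and eta: "real_distribution eta"
    and mu2: "integrable mu (\<lambda>x. x\<^sup>2)" and eta2: "integrable eta (\<lambda>x. x\<^sup>2)"
begin

text \<open>Every set of vertices receives a law, edge or not. It depends only on the summand of the
  index, so column shifts preserve it.\<close>

definition law :: "(nat \<times> 'h) + (nat \<times> 'h) set \<Rightarrow> real measure" where
  "law = case_sum (\<lambda>_. mu) (\<lambda>_. eta)"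

sublocale product_of_laws law
proof (rule product_of_laws.intro)
  show "real_distribution (law k)" for k
    using mu eta by (cases k) (simp_all add: law_def)
qed

text \<open>The sum dominates the second moment of either kind of weight, which spares a case
  distinction.\<close>

definition second_moment :: real where
  "second_moment = (\<integral>x. x\<^sup>2 \<partial>mu) + (\<integral>x. x\<^sup>2 \<partial>eta)"

lemma integrable_law: "integrable (law k) (\<lambda>x. x\<^sup>2)"
  by (cases k) (auto simp: law_def mu2 eta2)

lemma square_integrable_component: "square_integrable P (\<lambda>w. w k)"
proof -
  have "integrable (distr P borel (\<lambda>w. w k)) (\<lambda>x. x\<^sup>2)"
    using integrable_law by (simp add: distr_component)
  then have "integrable P (\<lambda>w. (w k)\<^sup>2)"
    by (subst (asm) integrable_distr_eq) (auto simp: component_measurable)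
  then show ?thesis by (simp add: square_integrable_def component_measurable)
qed

lemma expectation_component_le: "expectation (\<lambda>w. (w k)\<^sup>2) \<le> second_moment"
proof -
  have "expectation (\<lambda>w. (w k)\<^sup>2) = (\<integral>x. x\<^sup>2 \<partial>law k)"
    unfolding distr_component[symmetric, of k] by (subst integral_distr) (auto simp: component_measurable)
  also have "\<dots> \<le> second_moment"
    by (cases k) (simp_all add: law_def second_moment_def)
  finally show ?thesis .
qed

definition F :: "nat \<Rightarrow> nat \<Rightarrow> ((nat \<times> 'h) + (nat \<times> 'h) set \<Rightarrow> real) \<Rightarrow> real" where
  "F a b = ln_Z (column_verts VH a b) (column_edges VH EH a b)"

definition slots :: "nat \<Rightarrow> nat \<Rightarrow> ((nat \<times> 'h) + (nat \<times> 'h) set) set" where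
  "slots a b = column_verts VH a b <+> column_edges VH EH a b"

definition local_fns :: "nat \<Rightarrow> nat \<Rightarrow> (((nat \<times> 'h) + (nat \<times> 'h) set \<Rightarrow> real) \<Rightarrow> real) set" where
  "local_fns a b = {g \<in> borel_measurable P. depends_on (slots a b) g}"

lemmas finite_cols = finite_column_verts[OF fin] finite_column_edges[OF fin]

lemma square_integrable_F: "square_integrable P (F a b)"
  unfolding F_def
  using square_integrable_ln_Z[of "\<lambda>k w. w k", OF square_integrable_component finite_cols column_edges_sub[OF simple]]
  by simp

lemma slots_mono: "a \<le> a' \<Longrightarrow> b' \<le> b \<Longrightarrow> slots a' b' \<subseteq> slots a b"
  unfolding slots_def using column_verts_mono[of a a' b' b VH] column_edges_mono[of a a' b' b VH EH] by blast

text \<open>Edges are nonempty, so vertex-disjoint pieces share no edge either.\<close>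

lemma slots_disjoint: "b \<le> a' \<Longrightarrow> slots a b \<inter> slots a' c = {}"
proof -
  assume "b \<le> a'"
  then have disj: "column_verts VH a b \<inter> column_verts VH a' c = {}" by (auto simp: column_verts_def)
  have "x \<notin> slots a' c" if "x \<in> slots a b" for x
  proof (cases x)
    case (Inl v)
    then show ?thesis using that disj by (auto simp: slots_def)
  next
    case (Inr e)
    have "\<not> (e \<in> column_edges VH EH a b \<and> e \<in> column_edges VH EH a' c)"
      using column_edges_sub[OF simple, of e] disj by blast
    then show ?thesis using that Inr by (auto simp: slots_def)
  qed
  then show ?thesis by blast
qed

text \<open>The 3 counts the weights involved: that of the edge and those of its two
  endpoints.\<close>

lemma weight_bound_moments:
  assumes "e \<in> cylinder VH EH"
  shows "square_integrable P (\<lambda>w. weight_bound w e)"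
    and "expectation (\<lambda>w. (weight_bound w e)\<^sup>2) \<le> 4 * (1 + 3 * second_moment)"
proof -
  show sq: "square_integrable P (\<lambda>w. weight_bound w e)"
    using square_integrable_weight_bound[of "\<lambda>k w. w k"] square_integrable_component by simp
  have card: "card e = 2" using card_cylinder[OF simple assms] .
  note int = square_integrableD(2)[OF square_integrable_component]
  have "expectation (\<lambda>w. (weight_bound w e)\<^sup>2)
      \<le> expectation (\<lambda>w. 4 * (1 + (w (Inr e))\<^sup>2 + (\<Sum>v\<in>e. (w (Inl v))\<^sup>2)))"
    using square_integrableD(2)[OF sq] int weight_bound_squared_le[OF card]
    by (intro integral_mono) auto
  also have "\<dots> = 4 * (1 + expectation (\<lambda>w. (w (Inr e))\<^sup>2) + (\<Sum>v\<in>e. expectation (\<lambda>w. (w (Inl v))\<^sup>2)))"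
    using int by (simp add: prob_space)
  also have "(\<Sum>v\<in>e. expectation (\<lambda>w. (w (Inl v))\<^sup>2)) \<le> 2 * second_moment"
    using sum_bounded_above[of e "\<lambda>v. expectation (\<lambda>w. (w (Inl v))\<^sup>2)" second_moment]
      expectation_component_le card by simp
  also have "expectation (\<lambda>w. (w (Inr e))\<^sup>2) \<le> second_moment" by (rule expectation_component_le)
  finally show "expectation (\<lambda>w. (weight_bound w e)\<^sup>2) \<le> 4 * (1 + 3 * second_moment)" by simp
qed

lemma second_moment_nonneg: "0 \<le> second_moment"
  by (simp add: second_moment_def)

text \<open>Cauchy-Schwarz over at most \<open>card VH\<close> crossing edges, each with the second
  moment from \<open>weight_bound_moments\<close>; hence the square of the cardinality.\<close>

definition defect_bound :: real where
  "defect_bound = sqrt (4 * (1 + 3 * second_moment) * (real (card VH))\<^sup>2)"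

lemma F_defect:
  assumes "a \<le> b" "b \<le> c"
  shows "sdev (\<lambda>w. F a c w - F a b w - F b c w) \<le> defect_bound"
proof -
  define E E0 where "E = column_edges VH EH a c" and "E0 = column_edges VH EH a b \<union> column_edges VH EH b c"
  let ?g = "\<lambda>w. F a c w - F a b w - F b c w" and ?D = "\<lambda>w. \<Sum>e\<in>E - E0. weight_bound w e"
  have E: "E0 \<subseteq> E" "finite E"
    using column_edges_mono[of a a b c VH EH] column_edges_mono[of a b c c VH EH] assms finite_cols
    by (auto simp: E_def E0_def)
  have "finite ((\<lambda>j. {(b, j), (b + 1, j)}) ` VH)" using fin by simp
  then have "card (E - E0) \<le> card ((\<lambda>j. {(b, j), (b + 1, j)}) ` VH)"
    unfolding E_def E0_def by (rule card_mono[OF _ column_edges_crossing[OF assms]])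
  then have card: "card (E - E0) \<le> card VH" using card_image_le[OF fin] order_trans by blast
  have cyl: "e \<in> cylinder VH EH" if "e \<in> E" for e using that by (auto simp: E_def column_edges_def)
  have g: "0 \<le> ?g w \<and> ?g w \<le> ?D w" for w
  proof -
    let ?nu = "\<lambda>v. w (Inl v)" and ?om = "\<lambda>e. w (Inr e)"
    \<comment> \<open>Without the crossing edges the two sides are disconnected and the partition
      function factorises.\<close>
    have "partition_fn (column_verts VH a c) E0 ?nu ?om
        = partition_fn (column_verts VH a b) (column_edges VH EH a b) ?nu ?om
          * partition_fn (column_verts VH b c) (column_edges VH EH b c) ?nu ?om"
      unfolding column_verts_Un[OF assms] E0_def
      using column_edges_sub[OF simple] by (intro partition_fn_disjoint_union finite_cols column_verts_Int) auto
    then have "ln (partition_fn (column_verts VH a c) E0 ?nu ?om) = F a b w + F b c w"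
      using partition_fn_pos[OF finite_cols(2), of "column_verts VH a b" EH a b ?nu ?om]
        partition_fn_pos[OF finite_cols(2), of "column_verts VH b c" EH b c ?nu ?om]
      by (simp add: F_def ln_Z_def ln_mult)
    then show ?thesis
      using ln_partition_fn_diff[of "column_verts VH a c" E E0 ?nu ?om] E finite_cols column_edges_sub[OF simple, of _ a c]
      by (simp add: F_def ln_Z_def E_def[symmetric] weight_bound_def)
  qed
  have sq: "square_integrable P ?g" "square_integrable P ?D"
    by (intro square_integrable_diff square_integrable_F) (intro square_integrable_sum weight_bound_moments(1) cyl, simp)
  note intw = square_integrableD(2)[OF weight_bound_moments(1)[OF cyl]]
  \<comment> \<open>The second moment dominates the variance and, unlike it, can be bounded
    pointwise through \<open>g\<close>.\<close>
  have "variance ?g \<le> expectation (\<lambda>w. (?g w)\<^sup>2)"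
    using variance_eq[OF square_integrableD(3,2)[OF sq(1)]] by simp
  also have "\<dots> \<le> expectation (\<lambda>w. (\<Sum>e\<in>E - E0. (weight_bound w e)\<^sup>2) * real (card (E - E0)))"
  proof (rule integral_mono)
    show "integrable P (\<lambda>w. (?g w)\<^sup>2)" using sq(1) by (rule square_integrableD)
    show "integrable P (\<lambda>w. (\<Sum>e\<in>E - E0. (weight_bound w e)\<^sup>2) * real (card (E - E0)))"
      using intw by (intro integrable_mult_left Bochner_Integration.integrable_sum) auto
    fix w
    have "(?g w)\<^sup>2 \<le> (?D w)\<^sup>2" using g[of w] by (intro power_mono) auto
    also have "\<dots> \<le> (\<Sum>e\<in>E - E0. (weight_bound w e)\<^sup>2) * real (card (E - E0))"
      by (rule sum_squared_le_sum_of_squares)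
    finally show "(?g w)\<^sup>2 \<le> (\<Sum>e\<in>E - E0. (weight_bound w e)\<^sup>2) * real (card (E - E0))" .
  qed
  also have "\<dots> = (\<Sum>e\<in>E - E0. expectation (\<lambda>w. (weight_bound w e)\<^sup>2)) * real (card (E - E0))"
    using intw by simp
  also have "\<dots> \<le> (\<Sum>e\<in>E - E0. 4 * (1 + 3 * second_moment)) * real (card (E - E0))"
    using cyl by (intro mult_right_mono sum_mono weight_bound_moments(2)) auto
  also have "\<dots> = 4 * (1 + 3 * second_moment) * (real (card (E - E0)))\<^sup>2"
    by (simp add: power2_eq_square algebra_simps)
  also have "\<dots> \<le> 4 * (1 + 3 * second_moment) * (real (card VH))\<^sup>2"
    using card second_moment_nonneg by (intro mult_left_mono power_mono) auto
  finally show ?thesis unfolding sdev_def defect_bound_def by (rule real_sqrt_le_mono)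
qed

text \<open>Shifting columns relabels the weights injectively and keeps their laws.\<close>

lemma F_stationary: "distr P borel (F a (a + m)) = distr P borel (F 0 m)"
proof -
  let ?s = "map_sum (shift a) ((`) (shift a)) :: _ \<Rightarrow> (nat \<times> 'h) + (nat \<times> 'h) set"
  have "F a (a + m) w = F 0 m (\<lambda>k. w (?s k))" for w
    unfolding F_def ln_Z_def shift_column_verts[symmetric] shift_column_edges[symmetric]
    by (simp add: partition_fn_image[OF inj_shift])
  moreover have "inj ?s"
    by (intro sum.inj_map inj_shift) (auto intro!: injI simp: inj_image_eq_iff[OF inj_shift])
  moreover have "law (?s k) = law k" for k by (cases k) (auto simp: law_def)
  ultimately show ?thesis
    using distr_reindex[of ?s "F 0 m"] square_integrableD(1)[OF square_integrable_F] by presburger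
qed

lemma F_local: "F a b \<in> local_fns a b"
  using square_integrableD(1)[OF square_integrable_F, of a b] depends_on_ln_Z
  by (simp add: local_fns_def F_def slots_def)

sublocale near_additive_process P F local_fns defect_bound
proof
  show "square_integrable P (F a b)" for a b by (rule square_integrable_F)
  show "F a b \<in> local_fns a b" for a b by (rule F_local)
  show "local_fns a' b' \<subseteq> local_fns a b" if "a \<le> a'" "b' \<le> b" for a b a' b'
    using depends_on_mono[OF _ slots_mono[OF that]] by (auto simp: local_fns_def)
  show "(\<lambda>w. X w + Y w) \<in> local_fns a b" if "X \<in> local_fns a b" "Y \<in> local_fns a b" for X Y a b
    using that by (auto simp: local_fns_def depends_on_def intro!: arg_cong2[of _ _ _ _ "(+)"])
  show "(\<lambda>w. X w - Y w) \<in> local_fns a b" if "X \<in> local_fns a b" "Y \<in> local_fns a b" for X Y a b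
    using that by (auto simp: local_fns_def depends_on_def intro!: arg_cong2[of _ _ _ _ "(-)"])
  show "(\<lambda>w. 0) \<in> local_fns a b" for a b by (auto simp: local_fns_def depends_on_def)
  show "indep_var borel X borel Y" if "X \<in> local_fns a b" "Y \<in> local_fns b c" for a b c X Y
    using that slots_disjoint[of b b a c] unfolding local_fns_def
    by (intro indep_var_depends_on[where A = "slots a b" and B = "slots b c"]) auto
  show "sdev (\<lambda>w. F a c w - F a b w - F b c w) \<le> defect_bound" if "a \<le> b" "b \<le> c" for a b c
    using that by (rule F_defect)
  show "distr P borel (F a (a + m)) = distr P borel (F 0 m)" for a m by (rule F_stationary)
  show "indep_vars (\<lambda>_. borel) (\<lambda>k. F (k * L) (k * L + L)) UNIV" for L
  proof (rule indep_vars_depends_on[where A = "\<lambda>k. slots (k * L) (k * L + L)"])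
    show "F (k * L) (k * L + L) \<in> borel_measurable P"
      and "depends_on (slots (k * L) (k * L + L)) (F (k * L) (k * L + L))" for k
      using F_local by (auto simp: local_fns_def)
    show "disjoint_family (\<lambda>k. slots (k * L) (k * L + L))"
      unfolding disjoint_family_on_def
    proof (intro ballI impI)
      fix j k :: nat assume "j \<noteq> k"
      then consider "j < k" | "k < j" by linarith
      then show "slots (j * L) (j * L + L) \<inter> slots (k * L) (k * L + L) = {}"
      proof cases
        case 1
        then have "Suc j * L \<le> k * L" by (intro mult_right_mono) auto
        then show ?thesis by (intro slots_disjoint) simp
      next
        case 2
        then have "Suc k * L \<le> j * L" by (intro mult_right_mono) auto
        then have "slots (k * L) (k * L + L) \<inter> slots (j * L) (j * L + L) = {}"
          by (intro slots_disjoint) simp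
        then show ?thesis by blast
      qed
    qed
  qed
qed

end

section \<open>Positivity of the limit variance and the theorem\<close>

text \<open>The increment of \<open>ln (A + B * exp x)\<close> from \<open>x = a\<close> to
  \<open>x = b\<close> in the extreme case \<open>A = B * exp D\<close>. For \<open>a < b\<close> it
  shrinks as the ratio \<open>A / B\<close> grows.\<close>

definition gain :: "real \<Rightarrow> real \<Rightarrow> real \<Rightarrow> real" where
  "gain a b D = ln ((exp D + exp b) / (exp D + exp a))"

lemma gain_pos: "a < b \<Longrightarrow> 0 < gain a b D"
  unfolding gain_def by (intro ln_gt_zero) (simp add: add_pos_pos)

lemma gain_le:
  assumes "a < b" "0 \<le> A" "0 < B" "A \<le> B * exp D" "D \<le> D'"
  shows "gain a b D' \<le> ln (A + B * exp b) - ln (A + B * exp a)"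
proof -
  have pos: "0 < A + B * exp x" for x using assms by (simp add: add_nonneg_pos)
  have "B * exp D \<le> B * exp D'" using assms by simp
  with assms(4) have "A \<le> B * exp D'" by (rule order_trans)
  \<comment> \<open>Expanded, this is the cross-multiplied comparison of the two quotients.\<close>
  then have "0 \<le> (exp b - exp a) * (B * exp D' - A)" using assms by (intro mult_nonneg_nonneg) auto
  then have "(exp D' + exp b) * (A + B * exp a) \<le> (A + B * exp b) * (exp D' + exp a)"
    by (simp add: algebra_simps)
  then have "(exp D' + exp b) / (exp D' + exp a) \<le> (A + B * exp b) / (A + B * exp a)"
    using pos by (simp add: divide_le_eq le_divide_eq add_pos_pos mult.commute)
  then have "gain a b D' \<le> ln ((A + B * exp b) / (A + B * exp a))"
    unfolding gain_def using pos by (intro ln_mono) (auto intro!: divide_pos_pos add_pos_pos)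
  also have "\<dots> = ln (A + B * exp b) - ln (A + B * exp a)" using pos[of a, THEN less_imp_neq] pos[of b, THEN less_imp_neq] by (simp add: ln_div)
  finally show ?thesis .
qed

section \<open>Lower bound for the variance\<close>

context random_cylinder
begin

text \<open>Bounds the mean of the summed \<open>weight_bound\<close> near one weight: the number of
  incident edges times a bound for each mean, the latter from
  \<open>x \<le> 1 + x\<^sup>2\<close>.\<close>

definition incidence_bound :: real where
  "incidence_bound = 2 ^ (4 * card VH) * (1 + 4 * (1 + 3 * second_moment))"

lemma square_integrable_F_update: "square_integrable P (\<lambda>w. F a b (w(k := x)))"
proof -
  have "square_integrable P (\<lambda>w. (w(k := x)) k')" for k'
    by (cases "k' = k") (simp_all add: square_integrable_const square_integrable_component)
  from square_integrable_ln_Z[of "\<lambda>k' w. (w(k := x)) k'", OF this finite_cols column_edges_sub[OF simple]]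
  show ?thesis unfolding F_def .
qed

lemma F_affine:
  assumes "k \<in> slots a b"
  obtains A B where "0 \<le> A" "0 < B"
    "A \<le> B * exp (\<Sum>e | e \<in> column_edges VH EH a b \<and> e \<inter> endpoints k \<noteq> {}. weight_bound w e)"
    "\<And>x. F a b (w(k := x)) = ln (A + B * exp x)"
proof -
  obtain A B where AB: "0 \<le> A" "0 < B"
      "A \<le> B * exp (\<Sum>e | e \<in> column_edges VH EH a b \<and> e \<inter> endpoints k \<noteq> {}. weight_bound w e)"
      "\<And>x. ln_Z (column_verts VH a b) (column_edges VH EH a b) (w(k := x)) = ln (A + B * exp x)"
    using partition_fn_affine[of "column_verts VH a b" "column_edges VH EH a b" k w,
        OF finite_cols column_edges_sub[OF simple] assms[unfolded slots_def]] by blast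
  show thesis by (rule that[OF AB(1-3)]) (simp add: F_def AB(4))
qed

lemma F_update_mono:
  assumes "k \<in> slots a b" "x \<le> y"
  shows "F a b (w(k := x)) \<le> F a b (w(k := y))"
proof -
  obtain A B where AB: "0 \<le> A" "0 < B" "\<And>x. F a b (w(k := x)) = ln (A + B * exp x)"
    by (rule F_affine[OF assms(1), of w]) (rule that)
  have "0 < A + B * exp x" using AB(1,2) by (simp add: add_nonneg_pos)
  moreover have "A + B * exp x \<le> A + B * exp y" using AB(2) assms(2) by simp
  ultimately show ?thesis unfolding AB(3) by (simp only: ln_mono)
qed

text \<open>The increment is at least \<open>gain a b D\<close> with a random \<open>D\<close> of
  mean at most \<open>incidence_bound\<close>. By Markov's inequality \<open>D\<close> exceeds twice
  that bound with probability at most one half, which explains both factors 2.\<close>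

lemma expected_increment:
  assumes k: "k \<in> slots 0 n" "endpoints k \<subseteq> {i, i + 1} \<times> UNIV" and ab: "a < b"
  shows "gain a b (2 * incidence_bound) / 2
    \<le> expectation (\<lambda>w. F 0 n (w(k := b))) - expectation (\<lambda>w. F 0 n (w(k := a)))"
proof -
  define I where "I = {e \<in> column_edges VH EH 0 n. e \<inter> endpoints k \<noteq> {}}"
  define D where "D = (\<lambda>w. \<Sum>e\<in>I. weight_bound w e)"
  define C where "C = incidence_bound"
  define G where "G = gain a b (2 * C)"
  have C: "0 < C" using second_moment_nonneg by (simp add: C_def incidence_bound_def)
  have G: "0 < G" unfolding G_def by (rule gain_pos[OF ab])
  have cyl: "e \<in> cylinder VH EH" if "e \<in> I" for e using that by (auto simp: I_def column_edges_def)
  note wb = weight_bound_moments[OF cyl]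
  have intw: "integrable P (\<lambda>w. weight_bound w e)" if "e \<in> I" for e
    using square_integrableD(3)[OF wb(1)[OF that]] .
  have "expectation D = (\<Sum>e\<in>I. expectation (\<lambda>w. weight_bound w e))"
    unfolding D_def using intw by (simp add: Bochner_Integration.integral_sum)
  also have "\<dots> \<le> (\<Sum>e\<in>I. 1 + 4 * (1 + 3 * second_moment))"
  proof (rule sum_mono)
    fix e assume e: "e \<in> I"
    have "expectation (\<lambda>w. weight_bound w e) \<le> expectation (\<lambda>w. 1 + (weight_bound w e)\<^sup>2)"
    proof (rule integral_mono)
      show "integrable P (\<lambda>w. 1 + (weight_bound w e)\<^sup>2)"
        using square_integrableD(2)[OF wb(1)[OF e]] by simp
      show "weight_bound w e \<le> 1 + (weight_bound w e)\<^sup>2" for w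
        using zero_le_power2[of "weight_bound w e - 1"] zero_le_power2[of "weight_bound w e"]
        unfolding power2_diff one_power2 mult_1_right by linarith
    qed (rule intw[OF e])
    also have "\<dots> = 1 + expectation (\<lambda>w. (weight_bound w e)\<^sup>2)"
      using square_integrableD(2)[OF wb(1)[OF e]] by (simp add: prob_space)
    finally show "expectation (\<lambda>w. weight_bound w e) \<le> 1 + 4 * (1 + 3 * second_moment)"
      using wb(2)[OF e] by linarith
  qed
  also have "\<dots> = real (card I) * (1 + 4 * (1 + 3 * second_moment))" by simp
  also have "\<dots> \<le> 2 ^ (4 * card VH) * (1 + 4 * (1 + 3 * second_moment))"
  proof (rule mult_right_mono)
    have "card I \<le> 2 ^ (4 * card VH)" unfolding I_def by (rule card_incident_edges[OF fin k(2)])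
    then show "real (card I) \<le> 2 ^ (4 * card VH)" by (metis of_nat_le_iff of_nat_numeral of_nat_power)
  qed (use second_moment_nonneg in simp)
  finally have ED: "expectation D \<le> C" by (simp add: C_def incidence_bound_def)
  have intD: "integrable P D" unfolding D_def using intw by (rule Bochner_Integration.integrable_sum)
  note intF = square_integrableD(3)[OF square_integrable_F_update]
  \<comment> \<open>Markov's inequality in integrated form: \<open>1 - D / (2 * C)\<close> is at
    most the indicator of \<open>D \<le> 2 * C\<close>, and its mean is at least one half.\<close>
  have "G / 2 \<le> G * (1 - expectation D / (2 * C))"
  proof -
    have "expectation D / (2 * C) \<le> 1 / 2" using ED C by (simp add: divide_le_eq)
    then have "G * (1 / 2) \<le> G * (1 - expectation D / (2 * C))" using G by (intro mult_left_mono) auto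
    then show ?thesis by simp
  qed
  also have "\<dots> = expectation (\<lambda>w. G * (1 - D w / (2 * C)))"
    using intD by (simp add: prob_space)
  also have "\<dots> \<le> expectation (\<lambda>w. F 0 n (w(k := b)) - F 0 n (w(k := a)))"
  proof (rule integral_mono)
    show "integrable P (\<lambda>w. G * (1 - D w / (2 * C)))" using intD by simp
    show "integrable P (\<lambda>w. F 0 n (w(k := b)) - F 0 n (w(k := a)))" using intF by simp
    fix w
    have D0: "0 \<le> D w" unfolding D_def weight_bound_def by (intro sum_nonneg edge_bound_nonneg)
    show "G * (1 - D w / (2 * C)) \<le> F 0 n (w(k := b)) - F 0 n (w(k := a))"
    proof (cases "D w \<le> 2 * C")
      case True
      obtain A B where AB: "0 \<le> A" "0 < B"
          "A \<le> B * exp (\<Sum>e | e \<in> column_edges VH EH 0 n \<and> e \<inter> endpoints k \<noteq> {}. weight_bound w e)"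
          "\<And>x. F 0 n (w(k := x)) = ln (A + B * exp x)"
        by (rule F_affine[OF k(1), of w]) (rule that)
      then have A_le: "A \<le> B * exp (D w)" by (simp only: D_def I_def)
      have "G * (1 - D w / (2 * C)) \<le> G * 1" using G C D0 by (intro mult_left_mono) auto
      also have "\<dots> \<le> F 0 n (w(k := b)) - F 0 n (w(k := a))"
        unfolding AB(4) G_def using gain_le[OF ab AB(1,2) A_le True] by simp
      finally show ?thesis .
    next
      case False
      then have "1 - D w / (2 * C) \<le> 0" using C by (simp add: le_divide_eq)
      then have "G * (1 - D w / (2 * C)) \<le> 0" using G by (simp add: mult_nonneg_nonpos)
      also have "0 \<le> F 0 n (w(k := b)) - F 0 n (w(k := a))"
        using F_update_mono[OF k(1), of a b w] ab by simp
      finally show ?thesis .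
    qed
  qed
  also have "\<dots> = expectation (\<lambda>w. F 0 n (w(k := b))) - expectation (\<lambda>w. F 0 n (w(k := a)))"
    using intF by simp
  finally show ?thesis by (simp add: G_def C_def)
qed

text \<open>The test statistic counting the indices \<open>k\<close> with \<open>w (k i) \<ge> b\<close> has variance at most
  \<open>n - 1\<close> and covariance at least of order \<open>n - 1\<close> with the free energy; Cauchy-Schwarz
  then bounds the variance of the latter from below.\<close>

lemma variance_F_ge:
  assumes ab: "a < b" and n: "2 \<le> n"
    and k: "\<And>i. i \<in> {1..<n} \<Longrightarrow> k i \<in> slots 0 n"
      "\<And>i. endpoints (k i) \<subseteq> {i, i + 1} \<times> UNIV" "inj_on k {1..<n}" "\<And>i. law (k i) = lam"
  defines "c \<equiv> measure lam {b..} * measure lam {..a} * (gain a b (2 * incidence_bound) / 2)"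
  shows "c\<^sup>2 / 2 * real n \<le> variance (F 0 n)"
proof -
  define p where "p = measure lam {b..}"
  define U where "U = (\<lambda>i (w :: (nat \<times> 'h) + (nat \<times> 'h) set \<Rightarrow> real). indicat_real {b..} (w (k i)))"
  define T where "T = (\<lambda>I w. \<Sum>i\<in>I. U i w)"
  have U: "square_integrable P (U i)" for i unfolding U_def by (rule square_integrable_indicator) simp
  have T: "square_integrable P (T I)" for I unfolding T_def by (intro square_integrable_sum U)
  have EU: "expectation (U i) = p" for i unfolding U_def p_def by (simp add: expectation_indicator k(4))
  have varU: "variance (U i) \<le> 1" for i
  proof -
    have "variance (U i) \<le> expectation (\<lambda>w. (U i w)\<^sup>2)"
      using variance_eq[OF square_integrableD(3,2)[OF U]] by simp
    also have "(\<lambda>w. (U i w)\<^sup>2) = U i" by (auto simp: U_def indicator_def)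
    also have "expectation (U i) \<le> 1"
      unfolding EU p_def k(4)[of i, symmetric] by (rule prob_space.prob_le_1[OF prob_N])
    finally show ?thesis .
  qed
  have varT: "variance (T I) \<le> real (card I)" if "I \<subseteq> {1..<n}" for I
    using finite_subset[OF that finite_atLeastLessThan] that
  proof (induction I rule: finite_induct)
    case empty
    then show ?case by (simp add: T_def)
  next
    case (insert i I)
    have "k i \<notin> k ` I" using inj_on_image_mem_iff[OF k(3), of i I] insert.hyps(2) insert.prems by simp
    then have "indep_var borel (U i) borel (T I)"
      using square_integrableD(1)[OF U] square_integrableD(1)[OF T]
      by (intro indep_var_depends_on[where A = "{k i}" and B = "k ` I"])
         (auto simp: depends_on_def U_def T_def intro!: sum.cong)
    then have "variance (\<lambda>w. U i w + T I w) = variance (U i) + variance (T I)"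
      by (rule variance_indep_add[OF U T])
    moreover have "T (insert i I) = (\<lambda>w. U i w + T I w)"
      using insert.hyps by (simp add: T_def)
    moreover have "variance (T I) \<le> real (card I)" using insert by simp
    ultimately show ?case using varU[of i] insert.hyps by simp
  qed
  \<comment> \<open>The range stops at \<open>n - 1\<close> because an edge from column
    \<open>i\<close> to \<open>i + 1\<close> needs the latter column.\<close>
  let ?I = "{1..<n}"
  note intF = square_integrableD(3)[OF square_integrable_F[of 0 n]]
  have c: "0 \<le> c" using gain_pos[OF ab, of "2 * incidence_bound"] by (simp add: c_def)
  have intFU: "integrable P (\<lambda>w. F 0 n w * (U i w - p))" for i
    by (intro square_integrable_mult square_integrable_F square_integrable_diff U square_integrable_const)
  have ET: "expectation (T ?I) = real (n - 1) * p"
    unfolding T_def using square_integrableD(3)[OF U] by (simp add: EU)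
  have "real (n - 1) * c = (\<Sum>i\<in>?I. c)" by simp
  also have "\<dots> \<le> (\<Sum>i\<in>?I. expectation (\<lambda>w. F 0 n w * (U i w - p)))"
  proof (rule sum_mono)
    fix i assume i: "i \<in> ?I"
    have "c \<le> p * measure lam {..a} * (expectation (\<lambda>w. F 0 n (w(k i := b))) - expectation (\<lambda>w. F 0 n (w(k i := a))))"
      unfolding c_def p_def by (intro mult_left_mono expected_increment[OF k(1)[OF i] k(2) ab]) simp
    also have "\<dots> \<le> expectation (\<lambda>w. F 0 n w * (U i w - p))"
      using covariance_indicator_ge[OF square_integrable_F[of 0 n] square_integrable_F_update F_update_mono[OF k(1)[OF i]] ab]
      unfolding U_def p_def k(4) .
    finally show "c \<le> expectation (\<lambda>w. F 0 n w * (U i w - p))" .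
  qed
  also have "\<dots> = expectation (\<lambda>w. \<Sum>i\<in>?I. F 0 n w * (U i w - p))"
    using intFU by simp
  \<comment> \<open>\<open>F 0 n\<close> may be centred because the other factor has mean
    zero.\<close>
  also have "\<dots> = expectation (\<lambda>w. (F 0 n w - expectation (F 0 n)) * (T ?I w - expectation (T ?I)))"
  proof -
    have "(\<Sum>i\<in>?I. F 0 n w * (U i w - p)) = F 0 n w * (T ?I w - expectation (T ?I))" for w
      unfolding ET by (simp add: T_def sum_subtractf flip: sum_distrib_left)
    moreover have "expectation (\<lambda>w. (F 0 n w - expectation (F 0 n)) * (T ?I w - expectation (T ?I)))
        = expectation (\<lambda>w. F 0 n w * (T ?I w - expectation (T ?I)))
          - expectation (F 0 n) * expectation (\<lambda>w. T ?I w - expectation (T ?I))"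
    proof -
      have "integrable P (\<lambda>w. F 0 n w * (T ?I w - expectation (T ?I)))"
        by (intro square_integrable_mult square_integrable_F square_integrable_diff T square_integrable_const)
      moreover have "integrable P (\<lambda>w. T ?I w - expectation (T ?I))"
        using square_integrableD(3)[OF T] by simp
      ultimately show ?thesis by (simp only: left_diff_distrib integral_mult_right_zero
            Bochner_Integration.integral_diff integrable_mult_right)
    qed
    moreover have "expectation (\<lambda>w. T ?I w - expectation (T ?I)) = 0"
      using square_integrableD(3)[OF T] by (simp add: prob_space)
    ultimately show ?thesis by simp
  qed
  also have "\<dots> \<le> sdev (F 0 n) * sdev (T ?I)"
    by (rule covariance_le[OF square_integrable_F T])
  finally have "(real (n - 1) * c)\<^sup>2 \<le> (sdev (F 0 n) * sdev (T ?I))\<^sup>2"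
    using c by (intro power_mono) auto
  also have "\<dots> = variance (F 0 n) * variance (T ?I)"
    by (simp only: power_mult_distrib sdev_squared)
  also have "\<dots> \<le> variance (F 0 n) * real (n - 1)"
    using varT[of ?I] by (intro mult_left_mono variance_positive) simp_all
  finally have "real (n - 1) * (real (n - 1) * c\<^sup>2) \<le> real (n - 1) * variance (F 0 n)"
    by (simp add: power2_eq_square mult_ac)
  then have "real (n - 1) * c\<^sup>2 \<le> variance (F 0 n)"
    by (rule mult_left_le_imp_le) (use n in simp)
  moreover have "c\<^sup>2 / 2 * real n \<le> real (n - 1) * c\<^sup>2"
  proof -
    have "real n / 2 \<le> real (n - 1)" using n by simp
    then have "c\<^sup>2 * (real n / 2) \<le> c\<^sup>2 * real (n - 1)" by (intro mult_left_mono) auto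
    then show ?thesis by (simp add: mult.commute)
  qed
  ultimately show ?thesis by linarith
qed

text \<open>Whichever law is nondegenerate supplies one weight per column: a vertex in a fixed row
  \<open>j\<close>, or the edge of that row to the next column. Such edges exist whatever
  \<open>EH\<close> is.\<close>

lemma variance_growth:
  assumes "\<not> (degenerate_law mu \<and> degenerate_law eta)"
  obtains c where "0 < c" "\<And>n. 2 \<le> n \<Longrightarrow> c * real n \<le> variance (F 0 n)"
proof -
  obtain j where j: "j \<in> VH" using nonempty by blast
  have "\<exists>k lam. real_distribution lam \<and> \<not> degenerate_law lam \<and> integrable lam (\<lambda>x. x\<^sup>2) \<and>
      (\<forall>n i. i \<in> {1..<n} \<longrightarrow> k i \<in> slots 0 n) \<and>
      (\<forall>i. endpoints (k i) \<subseteq> {i, i + 1} \<times> UNIV) \<and> inj k \<and> (\<forall>i. law (k i) = lam)"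
  proof (cases "degenerate_law mu")
    case False
    have "inj (\<lambda>i::nat. Inl (i, j) :: (nat \<times> 'h) + (nat \<times> 'h) set)" by (auto intro: injI)
    then show ?thesis
      using False mu mu2 j
      by (intro exI[of _ "\<lambda>i. Inl (i, j)"] exI[of _ mu])
         (auto simp: law_def slots_def column_verts_def)
  next
    case True
    have "inj (\<lambda>i::nat. Inr {(i, j), (i + 1, j)} :: (nat \<times> 'h) + (nat \<times> 'h) set)"
      by (auto intro!: injI simp: doubleton_eq_iff)
    moreover have "{(i, j), (i + 1, j)} \<in> column_edges VH EH 0 n" if "i \<in> {1..<n}" for i n
      using that j by (auto simp: column_edges_def cylinder_def column_verts_def)
    ultimately show ?thesis
      using True assms eta eta2
      by (intro exI[of _ "\<lambda>i. Inr {(i, j), (i + 1, j)}"] exI[of _ eta])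
         (auto simp: law_def slots_def)
  qed
  then obtain k lam where *: "real_distribution lam \<and> \<not> degenerate_law lam \<and> integrable lam (\<lambda>x. x\<^sup>2) \<and>
      (\<forall>n i. i \<in> {1..<n} \<longrightarrow> k i \<in> slots 0 n) \<and>
      (\<forall>i. endpoints (k i) \<subseteq> {i, i + 1} \<times> UNIV) \<and> inj k \<and> (\<forall>i. law (k i) = lam)"
    by (elim exE) (rule that)
  then have lam: "real_distribution lam" "\<not> degenerate_law lam" "integrable lam (\<lambda>x. x\<^sup>2)"
    and inj: "inj k" by simp_all
  have k: "i \<in> {1..<n} \<Longrightarrow> k i \<in> slots 0 n" "endpoints (k i) \<subseteq> {i, i + 1} \<times> UNIV" "law (k i) = lam" for n i
    using * by simp_all
  interpret lam: real_distribution lam by (rule lam(1))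
  have "integrable lam (\<lambda>x. x)"
    by (rule lam.square_integrable_imp_integrable[OF _ lam(3)]) simp
  from nondegenerate_law[OF lam(1,2) this] obtain a b
    where ab: "a < b" "0 < measure lam {b..}" "0 < measure lam {..a}" .
  define c where "c = measure lam {b..} * measure lam {..a} * (gain a b (2 * incidence_bound) / 2)"
  have "0 < c" using ab gain_pos[OF ab(1)] by (simp add: c_def)
  show thesis
  proof (rule that)
    show "0 < c\<^sup>2 / 2" using \<open>0 < c\<close> by simp
    show "c\<^sup>2 / 2 * real n \<le> variance (F 0 n)" if "2 \<le> n" for n
      unfolding c_def by (rule variance_F_ge[OF ab(1) that k(1,2) inj_on_subset[OF inj] k(3)]) auto
  qed
qed

text \<open>\<open>log_Z\<close> is a function of finitely many independent weights, and their joint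
  law is a marginal of \<open>P\<close>.\<close>

lemma distr_log_Z:
  assumes rw: "random_weights M mu eta (cyl_verts n VH) (cyl_edges n VH EH) nu om" and n: "1 \<le> n"
  shows "log_Z VH EH n nu om \<in> borel_measurable M"
    and "distr M borel (log_Z VH EH n nu om) = distr P borel (F 0 n)"
proof -
  interpret M: prob_space M using rw by (simp add: random_weights_def)
  define I where "I = slots 0 n"
  define X where "X = case_sum nu om"
  have I: "cyl_verts n VH <+> cyl_edges n VH EH = I"
    by (simp add: I_def slots_def cyl_verts_eq_column_verts cyl_edges_eq_column_edges[OF simple])
  have ind: "M.indep_vars (\<lambda>_. borel) X I"
    using rw unfolding random_weights_def X_def I by blast
  have X [measurable]: "X k \<in> borel_measurable M" if "k \<in> I" for k
    using ind that by (auto simp: M.indep_vars_def2)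
  have law_X: "distr M borel (X k) = law k" if "k \<in> I" for k
    using rw that unfolding random_weights_def X_def law_def I[symmetric] by (auto split: sum.split)
  \<comment> \<open>Used to express independence as a product law; here \<open>1 \<le> n\<close>
    enters.\<close>
  have ne: "I \<noteq> {}"
    using nonempty n by (auto simp: I_def slots_def column_verts_def)
  have log_Z: "log_Z VH EH n nu om x = F 0 n (\<lambda>k. X k x)" for x
    by (simp add: log_Z_def F_def ln_Z_def X_def cyl_verts_eq_column_verts cyl_edges_eq_column_edges[OF simple])
  \<comment> \<open>Points of the product over \<open>I\<close> are undefined outside
    \<open>I\<close>; \<open>F 0 n\<close> does not see those coordinates.\<close>
  have "depends_on I (F 0 n)" using F_local[of 0 n] by (simp add: local_fns_def I_def)
  then have F_restrict: "F 0 n (restrict w I) = F 0 n w" for w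
    by (rule depends_onD) simp
  have m: "F 0 n \<in> borel_measurable (PiM I (\<lambda>_. borel))"
    unfolding F_def I_def slots_def
    by (rule measurable_ln_Z[where X = "\<lambda>k x. x k"]) (rule measurable_component_singleton)
  have mX: "(\<lambda>x. \<lambda>k\<in>I. X k x) \<in> measurable M (PiM I (\<lambda>_. borel))"
    by (intro measurable_restrict X)
  have mP: "(\<lambda>w. \<lambda>k\<in>I. w k) \<in> measurable P (PiM I (\<lambda>_. borel))"
    by (intro measurable_restrict component_measurable)
  have log_Z_comp: "log_Z VH EH n nu om = (\<lambda>x. F 0 n (\<lambda>k\<in>I. X k x))"
    by (rule ext) (simp only: log_Z F_restrict)
  show "log_Z VH EH n nu om \<in> borel_measurable M"
    unfolding log_Z_comp using mX m by (rule measurable_compose)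
  have "distr M borel (log_Z VH EH n nu om) = distr (distr M (PiM I (\<lambda>_. borel)) (\<lambda>x. \<lambda>k\<in>I. X k x)) borel (F 0 n)"
    unfolding log_Z_comp using distr_distr[OF m mX] by (simp add: comp_def)
  also have "distr M (PiM I (\<lambda>_. borel)) (\<lambda>x. \<lambda>k\<in>I. X k x) = PiM I (\<lambda>k. distr M borel (X k))"
    using M.indep_vars_iff_distr_eq_PiM'[OF ne, where X = X and M' = "\<lambda>_. borel"] X ind by blast
  also have "\<dots> = PiM I law" by (rule PiM_cong) (auto simp: law_X)
  also have "\<dots> = distr P (PiM I law) (\<lambda>w. \<lambda>k\<in>I. w k)"
    using distr_PiM_reindex[of UNIV law "\<lambda>k. k" I] prob_N by simp
  also have "\<dots> = distr P (PiM I (\<lambda>_. borel)) (\<lambda>w. \<lambda>k\<in>I. w k)"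
    by (intro distr_cong sets_PiM_cong) (auto simp: sets_N)
  also have "distr \<dots> borel (F 0 n) = distr P borel (F 0 n)"
    using distr_distr[OF m mP] F_restrict by (simp add: comp_def)
  finally show "distr M borel (log_Z VH EH n nu om) = distr P borel (F 0 n)" .
qed

end

lemma integrable_square_of_powr:
  assumes "real_distribution mu" "0 < \<epsilon>" "integrable mu (\<lambda>x. \<bar>x\<bar> powr (2 + \<epsilon>))"
  shows "integrable mu (\<lambda>x. x\<^sup>2)"
proof -
  interpret real_distribution mu by fact
  have le: "x\<^sup>2 \<le> 1 + \<bar>x\<bar> powr (2 + \<epsilon>)" for x :: real
  proof (cases "\<bar>x\<bar> \<le> 1")
    case True
    then have "x\<^sup>2 \<le> 1" by (simp add: abs_square_le_1)
    then show ?thesis using powr_ge_zero[of "\<bar>x\<bar>" "2 + \<epsilon>"] by linarith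
  next
    case False
    then have "x\<^sup>2 = \<bar>x\<bar> powr 2" by (simp add: powr_numeral)
    also have "\<dots> \<le> \<bar>x\<bar> powr (2 + \<epsilon>)" using False assms(2) by (intro powr_mono) auto
    finally show ?thesis by simp
  qed
  show ?thesis
  proof (rule Bochner_Integration.integrable_bound)
    show "integrable mu (\<lambda>x. 1 + \<bar>x\<bar> powr (2 + \<epsilon>))" using assms(3) by simp
    show "AE x in mu. norm (x\<^sup>2) \<le> norm (1 + \<bar>x\<bar> powr (2 + \<epsilon>))" using le by auto
  qed simp
qed

text \<open>\<open>\<sigma>\<close> is quantified before the spaces and the weights, so it cannot
  depend on how the weights are realised.\<close>

theorem theorem1p2:
  fixes VH :: "'h set" and EH :: "'h set set"
    and mu eta :: "real measure" and \<epsilon> :: real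
  assumes "finite VH" and "VH \<noteq> {}" and "simple_graph VH EH"
    and "real_distribution mu" and "real_distribution eta"
    and "\<not> (degenerate_law mu \<and> degenerate_law eta)"
    and "\<epsilon> > 0"
    and "integrable mu (\<lambda>x. \<bar>x\<bar> powr (2 + \<epsilon>))"
    and "integrable eta (\<lambda>x. \<bar>x\<bar> powr (2 + \<epsilon>))"
  shows "\<exists>\<sigma>>0. \<forall>(M :: nat \<Rightarrow> 'w measure) nu om.
    (\<forall>n\<ge>1. random_weights (M n) mu eta (cyl_verts n VH) (cyl_edges n VH EH) (nu n) (om n)) \<longrightarrow>
    (\<lambda>n. prob_space.variance (M n) (log_Z VH EH n (nu n) (om n)) / real n) \<longlonglongrightarrow> \<sigma>\<^sup>2 \<and>
    weak_conv_m
      (\<lambda>n. distr (M n) borel (\<lambda>x.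
         (log_Z VH EH n (nu n) (om n) x - prob_space.expectation (M n) (log_Z VH EH n (nu n) (om n)))
           / sqrt (real n)))
      (gaussian_law 0 \<sigma>)"
proof -
  interpret random_cylinder VH EH mu eta
    using assms by (auto simp: random_cylinder_def intro: integrable_square_of_powr)
  obtain c where c: "0 < c" "\<And>n. 2 \<le> n \<Longrightarrow> c * real n \<le> variance (F 0 n)"
    using variance_growth[OF assms(6)] by blast
  from central_limit[OF c] obtain \<sigma> where \<sigma>: "0 < \<sigma>"
    and var: "(\<lambda>n. variance (F 0 n) / real n) \<longlonglongrightarrow> \<sigma>\<^sup>2"
    and conv: "weak_conv_m (\<lambda>n. distr P borel (\<lambda>x. (F 0 n x - expectation (F 0 n)) / sqrt (real n))) (gaussian_law 0 \<sigma>)"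
    by blast
  show ?thesis
  proof (intro exI[of _ \<sigma>] conjI allI impI \<sigma>)
    fix M :: "nat \<Rightarrow> 'w measure" and nu om
    assume rw: "\<forall>n\<ge>1. random_weights (M n) mu eta (cyl_verts n VH) (cyl_edges n VH EH) (nu n) (om n)"
    let ?L = "\<lambda>n. log_Z VH EH n (nu n) (om n)"
    have L: "?L n \<in> borel_measurable (M n)" "distr (M n) borel (?L n) = distr P borel (F 0 n)" if "1 \<le> n" for n
      using distr_log_Z[of "M n" n "nu n" "om n"] rw that by auto
    have F: "F 0 n \<in> borel_measurable P" for n by (rule square_integrableD(1)[OF square_integrable_F])
    have int: "(\<integral>x. g (?L n x) \<partial>M n) = expectation (\<lambda>w. g (F 0 n w))"
      if "1 \<le> n" "g \<in> borel_measurable borel" for n and g :: "real \<Rightarrow> real"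
      using arg_cong[OF L(2)[OF that(1)], of "\<lambda>D. integral\<^sup>L D g"] L(1)[OF that(1)] F that(2)
      by (simp add: integral_distr)
    have exp: "prob_space.expectation (M n) (?L n) = expectation (F 0 n)" if "1 \<le> n" for n
      using int[OF that, of "\<lambda>y. y"] by simp
    have "variance (F 0 n) / real n = prob_space.variance (M n) (?L n) / real n" if "1 \<le> n" for n
      using int[OF that, of "\<lambda>y. (y - expectation (F 0 n))\<^sup>2"] exp[OF that] by simp
    \<comment> \<open>\<open>rw\<close> speaks of \<open>n \<ge> 1\<close> only; limits ignore the
      remaining index.\<close>
    then have "\<forall>\<^sub>F n in sequentially. variance (F 0 n) / real n = prob_space.variance (M n) (?L n) / real n"
      using eventually_ge_at_top[of 1] by (rule eventually_mono[rotated])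
    with var show "(\<lambda>n. prob_space.variance (M n) (?L n) / real n) \<longlonglongrightarrow> \<sigma>\<^sup>2"
      by (rule Lim_transform_eventually)
    let ?X = "\<lambda>n. distr (M n) borel (\<lambda>x. (?L n x - prob_space.expectation (M n) (?L n)) / sqrt (real n))"
    let ?Y = "\<lambda>n. distr P borel (\<lambda>x. (F 0 n x - expectation (F 0 n)) / sqrt (real n))"
    have "?Y n = ?X n" if "1 \<le> n" for n
    proof -
      let ?g = "\<lambda>y. (y - expectation (F 0 n)) / sqrt (real n)"
      have "?X n = distr (distr (M n) borel (?L n)) borel ?g"
        unfolding exp[OF that] by (subst distr_distr) (use L(1)[OF that] in \<open>auto simp: comp_def\<close>)
      also have "\<dots> = ?Y n"
        unfolding L(2)[OF that] by (subst distr_distr) (use F in \<open>auto simp: comp_def\<close>)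
      finally show ?thesis by simp
    qed
    then have eq: "\<forall>\<^sub>F n in sequentially. ?Y n = ?X n"
      using eventually_ge_at_top[of 1] by (rule eventually_mono[rotated])
    \<comment> \<open>Weak convergence is unfolded to distribution functions, so that equality of
      the laws for late \<open>n\<close> suffices.\<close>
    show "weak_conv_m ?X (gaussian_law 0 \<sigma>)"
      unfolding weak_conv_m_def weak_conv_def
    proof (intro allI impI)
      fix x assume "isCont (cdf (gaussian_law 0 \<sigma>)) x"
      then have "(\<lambda>n. cdf (?Y n) x) \<longlonglongrightarrow> cdf (gaussian_law 0 \<sigma>) x"
        using conv by (simp add: weak_conv_m_def weak_conv_def)
      moreover have "\<forall>\<^sub>F n in sequentially. cdf (?Y n) x = cdf (?X n) x"
        using eq by (rule eventually_mono) simp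
      ultimately show "(\<lambda>n. cdf (?X n) x) \<longlonglongrightarrow> cdf (gaussian_law 0 \<sigma>) x"
        by (rule Lim_transform_eventually)
    qed
  qed
qed

end
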